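(* Let $I$ and $J$ be two open, bounded, non-empty subsets of $\mathbb{R}$ such that $\overline I\cap\overline J=\emptyset$. Then there exists a constant $C=C(I,J)>0$ such that for any $f\in C_c^\infty(I)$ $$\|f\|_{L^2(I)}\le C\,e^{C\frac{\|f\|_{H^1(I)}}{\|f\|_{L^2(I)}}}\,\|Hf\|_{L^2(J)}.$$
   Context: $H$ denotes the Hilbert transform $Hf(x)=\frac1\pi\,\mathrm{p.v.}\int_{\mathbb{R}}\frac{f(y)}{x-y}dy$, i.e. the Fourier multiplier with symbol $-i\,\mathrm{sgn}(\xi)$; $f\in C_c^\infty(I)$ is extended by zero to $\mathbb{R}$. For $f=0$ the inequality is understood to hold trivially. *)

theory Defs
  imports "HOL-Analysis.Analysis"
begin

definition nth_vderiv :: "nat \<Rightarrow> (real \<Rightarrow> complex) \<Rightarrow> real \<Rightarrow> complex" where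
  "nth_vderiv k f = ((\<lambda>g x. vector_derivative g (at x)) ^^ k) f"

definition smooth :: "(real \<Rightarrow> complex) \<Rightarrow> bool" where
  "smooth f \<longleftrightarrow> (\<forall>k x. nth_vderiv k f differentiable (at x))"

text \<open>Test functions are represented by their extension by zero to the whole line. Since the
  (closed) support is a compact subset of the open set \<open>I\<close>, smoothness on \<open>I\<close> and smoothness of
  the extension on the line are the same condition.\<close>
definition Cc_infty :: "real set \<Rightarrow> (real \<Rightarrow> complex) set" where
  "Cc_infty I = {f. smooth f \<and> compact (closure {x. f x \<noteq> 0}) \<and> closure {x. f x \<noteq> 0} \<subseteq> I}"

definition L2_norm :: "real set \<Rightarrow> (real \<Rightarrow> complex) \<Rightarrow> real" where
  "L2_norm A f = sqrt (LINT x:A|lborel. (cmod (f x))\<^sup>2)"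

text \<open>The derivative is the classical one, so this is meaningful for differentiable functions
  (where it agrees with the weak derivative), which is the only case needed.\<close>
definition H1_norm :: "real set \<Rightarrow> (real \<Rightarrow> complex) \<Rightarrow> real" where
  "H1_norm A f = sqrt ((L2_norm A f)\<^sup>2 + (L2_norm A (\<lambda>x. vector_derivative f (at x)))\<^sup>2)"

text \<open>The principal value is the limit of the integrals over symmetric truncations
  \<open>\<bar>x - y\<bar> > \<epsilon>\<close> as \<open>\<epsilon>\<close> tends to 0 from the right.\<close>
definition Hilbert_transform :: "(real \<Rightarrow> complex) \<Rightarrow> real \<Rightarrow> complex" where
  "Hilbert_transform f x =
     complex_of_real (1 / pi) *
     Lim (at_right 0) (\<lambda>\<epsilon>::real. LINT y:{y. \<bar>x - y\<bar> > \<epsilon>}|lborel. f y / complex_of_real (x - y))"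

end

theory Submission
  imports Defs "HOL-Complex_Analysis.Complex_Analysis"
begin

text \<open>Let \<open>F(z) = 1/\<pi> \<integral> f(y) / (z - y) dy\<close>. Off the support of \<open>f\<close>, in particular on \<open>J\<close>, this is \<open>H f\<close>,
  and \<open>F(x + it) - F(x - it) = -2i P\<^sub>t f(x)\<close>. Translate so that \<open>0 \<in> J\<close>; then \<open>f\<close> lives on
  \<open>d \<le> \<bar>x\<bar> \<le> R\<close>. Since \<open>\<parallel>F(\<cdot> \<plusminus> i\<eta>)\<parallel> \<le> 2 \<parallel>f\<parallel>\<close> in \<open>L\<^sup>2\<close>, the holomorphic function
  \<open>h(\<zeta>) = \<integral> F(x\<zeta>) cnj (f x) dx\<close> over \<open>[d, R]\<close> satisfies \<open>\<bar>s\<bar> \<bar>h(s)\<bar>\<^sup>2 \<le> 4 \<parallel>f\<parallel>\<^sup>4\<close> on the real line, and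
  \<open>\<bar>s\<bar> \<bar>h(s)\<bar>\<^sup>2 \<le> \<parallel>f\<parallel>\<^sup>2 \<parallel>H f\<parallel>\<^sup>2\<close>, with the norm of \<open>H f\<close> over \<open>J\<close>, for small \<open>s\<close>: dilations move the whole
  support into \<open>J\<close>. The two-constants theorem bounds \<open>h(1 + i\<tau>)\<close> by a factor \<open>exp (-c A \<tau>)\<close>, where \<open>A\<close> measures
  the smallness of \<open>H f\<close> on \<open>J\<close>. Finally \<open>\<parallel>f\<parallel>\<^sup>2\<close> is recovered from \<open>h\<close> at \<open>1 \<plusminus> i\<tau>\<close> and \<open>1 \<plusminus> 2i\<tau>\<close> up to an error
  \<open>O(\<tau> \<parallel>f\<parallel> \<parallel>f\<parallel>\<^bsub>H1\<^esub>)\<close>, so \<open>\<tau>\<close> is taken to be a small multiple of \<open>\<parallel>f\<parallel> / \<parallel>f\<parallel>\<^bsub>H1\<^esub>\<close>. Having all bounds in \<open>L\<^sup>2\<close>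
  with constants independent of \<open>\<tau>\<close> is what avoids a logarithmic loss in the exponent.\<close>

subsection \<open>Integral inequalities\<close>

lemma integral_Cauchy_Schwarz:
  fixes f g :: "real \<Rightarrow> real"
  assumes "continuous_on {a..b} f" "continuous_on {a..b} g"
  shows "(integral {a..b} (\<lambda>x. f x * g x))\<^sup>2
    \<le> integral {a..b} (\<lambda>x. (f x)\<^sup>2) * integral {a..b} (\<lambda>x. (g x)\<^sup>2)"
proof -
  define P where "P = integral {a..b} (\<lambda>x. (f x)\<^sup>2)"
  define Q where "Q = integral {a..b} (\<lambda>x. (g x)\<^sup>2)"
  define B where "B = integral {a..b} (\<lambda>x. f x * g x)"
  have *: "0 \<le> s\<^sup>2 * P + 2 * s * t * B + t\<^sup>2 * Q" for s t
  proof -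
    have "((\<lambda>x. s\<^sup>2 * (f x)\<^sup>2 + 2 * s * t * (f x * g x) + t\<^sup>2 * (g x)\<^sup>2)
        has_integral (s\<^sup>2 * P + 2 * s * t * B + t\<^sup>2 * Q)) {a..b}"
      unfolding P_def Q_def B_def
      by (intro has_integral_add has_integral_mult_right integrable_integral
          integrable_continuous_interval continuous_intros assms)
    moreover have "0 \<le> s\<^sup>2 * (f x)\<^sup>2 + 2 * s * t * (f x * g x) + t\<^sup>2 * (g x)\<^sup>2" for x
      using zero_le_power2[of "s * f x + t * g x"] by (simp add: power2_eq_square algebra_simps)
    ultimately show ?thesis by (rule has_integral_nonneg)
  qed
  have Q0: "Q \<ge> 0" unfolding Q_def by (intro integral_nonneg integrable_continuous_interval
        continuous_intros assms) auto
  have "B\<^sup>2 \<le> P * Q"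
  proof (cases "Q = 0")
    case True
    have "B = 0"
    proof (rule ccontr)
      assume "B \<noteq> 0"
      \<comment> \<open>With Q = 0 the form is affine in t, and this t gives it the value
        -1.\<close>
      then show False using *[of 1 "- (P + 1) / (2 * B)"] True by (simp add: field_simps)
    qed
    then show ?thesis using True by simp
  next
    case False
    have "0 \<le> Q * (P * Q - B\<^sup>2)" using *[of Q "-B"] by (simp add: power2_eq_square algebra_simps)
    with False Q0 show ?thesis by (simp add: zero_le_mult_iff)
  qed
  then show ?thesis by (simp add: P_def Q_def B_def)
qed

text \<open>Apply the unweighted inequality to sqrt w and sqrt w * f. When w is a Poisson kernel the
  first factor is a mass of at most 1, so the result is a Jensen inequality.\<close>

lemma integral_Cauchy_Schwarz_weighted:
  fixes w f :: "real \<Rightarrow> real"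
  assumes w: "continuous_on {a..b} w" and f: "continuous_on {a..b} f"
    and "\<And>x. x \<in> {a..b} \<Longrightarrow> 0 \<le> w x"
  shows "(integral {a..b} (\<lambda>x. w x * f x))\<^sup>2
    \<le> integral {a..b} w * integral {a..b} (\<lambda>x. w x * (f x)\<^sup>2)"
proof -
  have "(integral {a..b} (\<lambda>x. sqrt (w x) * (sqrt (w x) * f x)))\<^sup>2
    \<le> integral {a..b} (\<lambda>x. (sqrt (w x))\<^sup>2) * integral {a..b} (\<lambda>x. (sqrt (w x) * f x)\<^sup>2)"
    by (intro integral_Cauchy_Schwarz continuous_intros assms)
  also have "integral {a..b} (\<lambda>x. sqrt (w x) * (sqrt (w x) * f x)) = integral {a..b} (\<lambda>x. w x * f x)"
    by (rule integral_cong) (use assms in \<open>simp add: mult.assoc[symmetric]\<close>)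
  also have "integral {a..b} (\<lambda>x. (sqrt (w x))\<^sup>2) = integral {a..b} w"
    by (rule integral_cong) (use assms in simp)
  also have "integral {a..b} (\<lambda>x. (sqrt (w x) * f x)\<^sup>2) = integral {a..b} (\<lambda>x. w x * (f x)\<^sup>2)"
    by (rule integral_cong) (use assms in \<open>simp add: power_mult_distrib\<close>)
  finally show ?thesis .
qed

lemma norm_integral_le_integral_norm:
  fixes f :: "real \<Rightarrow> complex"
  assumes "continuous_on {a..b} f"
  shows "cmod (integral {a..b} f) \<le> integral {a..b} (\<lambda>x. cmod (f x))"
  by (intro integral_norm_bound_integral integrable_continuous_interval continuous_intros assms) auto

lemma norm_integral_Cauchy_Schwarz:
  fixes f g :: "real \<Rightarrow> complex"
  assumes "continuous_on {a..b} f" "continuous_on {a..b} g"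
  shows "(cmod (integral {a..b} (\<lambda>x. f x * g x)))\<^sup>2
    \<le> integral {a..b} (\<lambda>x. (cmod (f x))\<^sup>2) * integral {a..b} (\<lambda>x. (cmod (g x))\<^sup>2)"
proof -
  have "cmod (integral {a..b} (\<lambda>x. f x * g x)) \<le> integral {a..b} (\<lambda>x. cmod (f x * g x))"
    by (intro norm_integral_le_integral_norm continuous_intros assms)
  then have "(cmod (integral {a..b} (\<lambda>x. f x * g x)))\<^sup>2 \<le> (integral {a..b} (\<lambda>x. cmod (f x) * cmod (g x)))\<^sup>2"
    by (intro power_mono) (auto simp: norm_mult)
  also have "\<dots> \<le> integral {a..b} (\<lambda>x. (cmod (f x))\<^sup>2) * integral {a..b} (\<lambda>x. (cmod (g x))\<^sup>2)"
    by (intro integral_Cauchy_Schwarz continuous_intros assms)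
  finally show ?thesis .
qed

lemma integral_zero_extend:
  fixes f :: "real \<Rightarrow> 'a::banach"
  assumes "continuous_on {a..b} f" "\<And>x. x \<notin> {a..b} \<Longrightarrow> f x = 0" "{a..b} \<subseteq> S"
  shows "f integrable_on S" "integral S f = integral {a..b} f"
proof -
  have "(f has_integral integral {a..b} f) S"
    by (rule has_integral_on_superset[OF integrable_integral[OF integrable_continuous_interval]])
      (use assms in auto)
  then show "f integrable_on S" "integral S f = integral {a..b} f" by auto
qed

lemma integral_swap_rectangle:
  fixes f :: "real \<Rightarrow> real \<Rightarrow> 'a::banach"
  assumes "continuous_on ({a..b} \<times> {c..d}) (\<lambda>(x, y). f x y)"
  shows "integral {a..b} (\<lambda>x. integral {c..d} (f x)) = integral {c..d} (\<lambda>y. integral {a..b} (\<lambda>x. f x y))"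
  using integral_swap_continuous[of a c b d f] assms by (simp only: cbox_Pair_eq box_real)

subsection \<open>Cauchy and Poisson integrals\<close>

text \<open>Serves both off the real axis and at real points z in a gap of the support: there the
  numerator vanishes near y = z and 0 / 0 = 0, so the same formula is an absolutely convergent
  integral.\<close>

definition cauchy_int :: "(real \<Rightarrow> complex) \<Rightarrow> real \<Rightarrow> complex \<Rightarrow> complex" where
  "cauchy_int f R z = integral {-R..R} (\<lambda>y. f y / (z - of_real y)) / of_real pi"

definition poisson_kernel :: "real \<Rightarrow> real \<Rightarrow> real" where
  "poisson_kernel t u = t / (pi * (u\<^sup>2 + t\<^sup>2))"

definition poisson_int :: "(real \<Rightarrow> complex) \<Rightarrow> real \<Rightarrow> real \<Rightarrow> real \<Rightarrow> complex" where
  "poisson_int f R t x = integral {-R..R} (\<lambda>y. of_real (poisson_kernel t (x - y)) * f y)"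

lemma sum_power2_neq_zero: "(t::real) \<noteq> 0 \<Longrightarrow> u\<^sup>2 + t\<^sup>2 \<noteq> 0"
  by (simp add: sum_power2_eq_zero_iff)

lemma continuous_on_poisson_kernel [continuous_intros]:
  assumes "continuous_on S g" "continuous_on S h" "\<And>x. x \<in> S \<Longrightarrow> g x \<noteq> 0"
  shows "continuous_on S (\<lambda>x. poisson_kernel (g x) (h x))"
  unfolding poisson_kernel_def
  by (intro continuous_intros assms) (use assms in \<open>auto simp: sum_power2_eq_zero_iff\<close>)

lemma poisson_kernel_nonneg: "t \<ge> 0 \<Longrightarrow> 0 \<le> poisson_kernel t u"
  by (simp add: poisson_kernel_def)

lemma has_integral_poisson_kernel:
  assumes "t > 0" "a \<le> b"
  shows "((\<lambda>x. poisson_kernel t (x - y)) has_integral (arctan ((b - y) / t) - arctan ((a - y) / t)) / pi) {a..b}"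
proof -
  have "((\<lambda>x. arctan ((x - y) / t) / pi) has_real_derivative poisson_kernel t (x - y)) (at x within {a..b})" for x
  proof -
    have "((\<lambda>x. arctan ((x - y) / t) / pi) has_real_derivative
        inverse (1 + ((x - y) / t)\<^sup>2) * (1 / t) / pi) (at x within {a..b})"
      using assms by (auto intro!: derivative_eq_intros)
    also have "inverse (1 + ((x - y) / t)\<^sup>2) * (1 / t) / pi = poisson_kernel t (x - y)"
      using assms by (simp add: poisson_kernel_def field_simps power2_eq_square)
    finally show ?thesis .
  qed
  then have "((\<lambda>x. poisson_kernel t (x - y)) has_integral arctan ((b - y) / t) / pi - arctan ((a - y) / t) / pi) {a..b}"
    by (intro fundamental_theorem_of_calculus assms) (auto simp: has_real_derivative_iff_has_vector_derivative)
  then show ?thesis by (simp add: diff_divide_distrib)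
qed

lemma integral_poisson_kernel_le_1:
  assumes "t > 0"
  shows "integral {a..b} (\<lambda>x. poisson_kernel t (x - y)) \<le> 1"
proof (cases "a \<le> b")
  case True
  have "arctan ((b - y) / t) - arctan ((a - y) / t) \<le> pi"
    using arctan_bounded[of "(b - y) / t"] arctan_bounded[of "(a - y) / t"] by simp
  then show ?thesis
    using integral_unique[OF has_integral_poisson_kernel[OF assms True, of y]] by simp
qed simp

lemma poisson_kernel_minus: "poisson_kernel t (- u) = poisson_kernel t u"
  by (simp add: poisson_kernel_def)

lemma integral_poisson_kernel_le_1':
  assumes "t > 0"
  shows "integral {a..b} (\<lambda>y. poisson_kernel t (x - y)) \<le> 1"
  using integral_poisson_kernel_le_1[OF assms, of a b x] poisson_kernel_minus[of t "_ - x"] by simp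

text \<open>Schur's test: the Poisson kernel has mass at most 1 in each variable. The mass in y
  enters through the weighted Cauchy-Schwarz inequality, the mass in x after exchanging the
  integrals. The bound depends on neither t nor [a, b].\<close>

lemma poisson_int_L2:
  fixes f :: "real \<Rightarrow> complex"
  assumes f: "continuous_on {-R..R} f" and t: "t > 0"
  shows "integral {a..b} (\<lambda>x. (cmod (poisson_int f R t x))\<^sup>2) \<le> integral {-R..R} (\<lambda>x. (cmod (f x))\<^sup>2)"
proof -
  let ?k = "\<lambda>x y. poisson_kernel t (x - y)"
  have cf2: "continuous_on ({a..b} \<times> {-R..R}) (\<lambda>z. f (snd z))"
    by (rule continuous_on_compose2[OF f]) (auto intro!: continuous_intros)
  have c1: "continuous_on ({a..b} \<times> {-R..R}) (\<lambda>(x, y). of_real (?k x y) * f y)"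
    unfolding split_beta using t cf2 by (auto intro!: continuous_intros)
  have c2: "continuous_on ({a..b} \<times> {-R..R}) (\<lambda>(x, y). ?k x y * (cmod (f y))\<^sup>2)"
    unfolding split_beta using t cf2 by (auto intro!: continuous_intros)
  have cP: "continuous_on {a..b} (poisson_int f R t)"
    unfolding poisson_int_def using integral_continuous_on_param[of "{a..b}" "-R" R] c1 by simp
  have cQ: "continuous_on {a..b} (\<lambda>x. integral {-R..R} (\<lambda>y. ?k x y * (cmod (f y))\<^sup>2))"
    using integral_continuous_on_param[of "{a..b}" "-R" R] c2 by simp
  have pt: "(cmod (poisson_int f R t x))\<^sup>2 \<le> integral {-R..R} (\<lambda>y. ?k x y * (cmod (f y))\<^sup>2)" for x
  proof -
    have "cmod (poisson_int f R t x) \<le> integral {-R..R} (\<lambda>y. cmod (of_real (?k x y) * f y))"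
      unfolding poisson_int_def using t
      by (intro norm_integral_le_integral_norm continuous_intros f) auto
    also have "\<dots> = integral {-R..R} (\<lambda>y. ?k x y * cmod (f y))"
      by (rule integral_cong) (use t in \<open>simp add: norm_mult poisson_kernel_nonneg\<close>)
    finally have "(cmod (poisson_int f R t x))\<^sup>2 \<le> (integral {-R..R} (\<lambda>y. ?k x y * cmod (f y)))\<^sup>2"
      by (rule power_mono) simp
    also have "\<dots> \<le> integral {-R..R} (?k x) * integral {-R..R} (\<lambda>y. ?k x y * (cmod (f y))\<^sup>2)"
      using t by (intro integral_Cauchy_Schwarz_weighted continuous_intros f) (auto simp: poisson_kernel_nonneg)
    also have "\<dots> \<le> 1 * integral {-R..R} (\<lambda>y. ?k x y * (cmod (f y))\<^sup>2)"
      using t by (intro mult_right_mono integral_poisson_kernel_le_1' integral_nonneg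
          integrable_continuous_interval continuous_intros f) (auto simp: poisson_kernel_nonneg)
    finally show ?thesis by simp
  qed
  have "integral {a..b} (\<lambda>x. (cmod (poisson_int f R t x))\<^sup>2)
      \<le> integral {a..b} (\<lambda>x. integral {-R..R} (\<lambda>y. ?k x y * (cmod (f y))\<^sup>2))"
    by (intro integral_le integrable_continuous_interval continuous_intros cP cQ pt)
  also have "\<dots> = integral {-R..R} (\<lambda>y. integral {a..b} (\<lambda>x. ?k x y * (cmod (f y))\<^sup>2))"
    by (rule integral_swap_rectangle[OF c2])
  also have "\<dots> = integral {-R..R} (\<lambda>y. integral {a..b} (\<lambda>x. ?k x y) * (cmod (f y))\<^sup>2)"
    by simp
  also have "\<dots> \<le> integral {-R..R} (\<lambda>y. (cmod (f y))\<^sup>2)"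
  proof (intro integral_le integrable_continuous_interval continuous_intros f)
    have "continuous_on ({-R..R} \<times> {a..b}) (\<lambda>(y, x). ?k x y)"
      unfolding split_beta using t by (auto intro!: continuous_intros)
    then show "continuous_on {-R..R} (\<lambda>y. integral {a..b} (\<lambda>x. ?k x y))"
      using integral_continuous_on_param[of "{-R..R}" a b "\<lambda>y x. ?k x y"] by simp
    show "integral {a..b} (\<lambda>x. ?k x y) * (cmod (f y))\<^sup>2 \<le> (cmod (f y))\<^sup>2" for y
      using mult_right_mono[OF integral_poisson_kernel_le_1[OF t, of a b y], of "(cmod (f y))\<^sup>2"] by simp
  qed
  finally show ?thesis .
qed

section \<open>Size and continuity of the Cauchy integral away from the support\<close>

lemma continuous_on_cauchy_integrand:
  fixes f :: "real \<Rightarrow> complex"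
  assumes f: "continuous_on S f" and "\<delta> > 0"
    and far: "\<And>y. y \<in> S \<Longrightarrow> f y \<noteq> 0 \<Longrightarrow> \<delta> \<le> cmod (z - of_real y)"
  shows "continuous_on S (\<lambda>y. f y / (z - of_real y))"
proof -
  \<comment> \<open>Write 1 / w as cnj w / |w|^2 and replace |w|^2 by its maximum with \<delta>^2:
    the result is continuous everywhere and unchanged wherever f y is nonzero.\<close>
  have "continuous_on S (\<lambda>y. f y * (cnj (z - of_real y) / of_real (max (\<delta>\<^sup>2) ((cmod (z - of_real y))\<^sup>2))))"
    using \<open>\<delta> > 0\<close> by (intro continuous_intros f) (auto simp: max_def)
  also have "?this \<longleftrightarrow> continuous_on S (\<lambda>y. f y / (z - of_real y))"
  proof (intro continuous_on_cong refl)
    fix y assume "y \<in> S"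
    show "f y * (cnj (z - of_real y) / of_real (max (\<delta>\<^sup>2) ((cmod (z - of_real y))\<^sup>2))) = f y / (z - of_real y)"
    proof (cases "f y = 0")
      case False
      then have le: "\<delta> \<le> cmod (z - of_real y)" using far \<open>y \<in> S\<close> by auto
      with \<open>\<delta> > 0\<close> have "\<delta>\<^sup>2 \<le> (cmod (z - of_real y))\<^sup>2" "z - of_real y \<noteq> 0" by (auto intro!: power_mono)
      then show ?thesis
        using complex_div_cnj[of "f y" "z - of_real y"] by (simp add: max_absorb2)
    qed simp
  qed
  finally show ?thesis .
qed

lemma integrable_cauchy_integrand:
  fixes f :: "real \<Rightarrow> complex"
  assumes "continuous_on {a..b} f" "\<delta> > 0"
    and "\<And>y. y \<in> {a..b} \<Longrightarrow> f y \<noteq> 0 \<Longrightarrow> \<delta> \<le> cmod (z - of_real y)"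
  shows "(\<lambda>y. f y / (z - of_real y)) integrable_on {a..b}"
  by (intro integrable_continuous_interval continuous_on_cauchy_integrand[OF assms])

lemma Im_le_dist_real: "\<bar>Im z\<bar> \<le> cmod (z - of_real y)"
  using abs_Im_le_cmod[of "z - of_real y"] by simp

lemma norm_cauchy_int_le:
  assumes f: "continuous_on {-R..R} f" and d: "\<delta> > 0"
    and far: "\<And>y. y \<in> {-R..R} \<Longrightarrow> f y \<noteq> 0 \<Longrightarrow> \<delta> \<le> cmod (z - of_real y)"
  shows "cmod (cauchy_int f R z) \<le> integral {-R..R} (\<lambda>y. cmod (f y)) / \<delta>"
proof -
  have "cmod (integral {-R..R} (\<lambda>y. f y / (z - of_real y))) \<le> integral {-R..R} (\<lambda>y. cmod (f y) / \<delta>)"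
  proof (intro integral_norm_bound_integral integrable_cauchy_integrand[OF f d far]
      integrable_continuous_interval continuous_intros f)
    show "cmod (f y / (z - of_real y)) \<le> cmod (f y) / \<delta>" if "y \<in> {-R..R}" for y
    proof (cases "f y = 0")
      case False
      then show ?thesis unfolding norm_divide using far[OF that] d by (intro divide_left_mono mult_pos_pos) auto
    qed simp
  qed (use d in auto)
  also have "\<dots> = integral {-R..R} (\<lambda>y. cmod (f y)) / \<delta>" by simp
  finally have 1: "cmod (integral {-R..R} (\<lambda>y. f y / (z - of_real y))) \<le> integral {-R..R} (\<lambda>y. cmod (f y)) / \<delta>" .
  have "cmod (cauchy_int f R z) = cmod (integral {-R..R} (\<lambda>y. f y / (z - of_real y))) / pi"
    unfolding cauchy_int_def by (simp add: norm_divide)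
  also have "\<dots> \<le> cmod (integral {-R..R} (\<lambda>y. f y / (z - of_real y))) / 1"
    using pi_gt3 by (intro divide_left_mono) auto
  finally show ?thesis using 1 by simp
qed

lemma norm_cauchy_int_far:
  assumes f: "continuous_on {-R..R} f" and "R > 0" "cmod z > R"
  shows "cmod (cauchy_int f R z) \<le> integral {-R..R} (\<lambda>y. cmod (f y)) / (cmod z - R)"
proof (rule norm_cauchy_int_le[OF f])
  fix y assume "y \<in> {-R..R}"
  then have "cmod (of_real y :: complex) \<le> R" by (simp only: norm_of_real) auto
  then show "cmod z - R \<le> cmod (z - of_real y)" using norm_triangle_ineq2[of z "of_real y"] by linarith
qed (use assms in auto)

text \<open>Resolvent identity: 1 / (z - y) - 1 / (w - y) = (w - z) / ((z - y) (w - y)). Only the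
  distance to the support of f enters, so z and w may lie on opposite sides of the real line if they
  face a gap.\<close>

lemma cauchy_int_Lipschitz:
  assumes f: "continuous_on {-R..R} f" and d: "\<delta> > 0"
    and z: "\<And>y. y \<in> {-R..R} \<Longrightarrow> f y \<noteq> 0 \<Longrightarrow> \<delta> \<le> cmod (z - of_real y)"
    and w: "\<And>y. y \<in> {-R..R} \<Longrightarrow> f y \<noteq> 0 \<Longrightarrow> \<delta> \<le> cmod (w - of_real y)"
  shows "cmod (cauchy_int f R z - cauchy_int f R w) \<le> cmod (z - w) * (integral {-R..R} (\<lambda>y. cmod (f y)) / \<delta>\<^sup>2)"
proof -
  let ?D = "\<lambda>y. f y / (z - of_real y) - f y / (w - of_real y)"
  have "cmod (integral {-R..R} ?D) \<le> integral {-R..R} (\<lambda>y. cmod (z - w) * (cmod (f y) / \<delta>\<^sup>2))"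
  proof (intro integral_norm_bound_integral integrable_diff integrable_cauchy_integrand[OF f d z]
      integrable_cauchy_integrand[OF f d w] integrable_continuous_interval continuous_intros f)
    show "cmod (?D y) \<le> cmod (z - w) * (cmod (f y) / \<delta>\<^sup>2)" if y: "y \<in> {-R..R}" for y
    proof (cases "f y = 0")
      case False
      then have le: "\<delta> \<le> cmod (z - of_real y)" "\<delta> \<le> cmod (w - of_real y)" using z w y by auto
      then have nz: "z - of_real y \<noteq> 0" "w - of_real y \<noteq> 0" using d by auto
      have "?D y = (w - z) * f y / ((z - of_real y) * (w - of_real y))"
        using nz by (simp add: field_simps)
      then have "cmod (?D y) = cmod (z - w) * (cmod (f y) / (cmod (z - of_real y) * cmod (w - of_real y)))"
        by (simp add: norm_mult norm_divide norm_minus_commute)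
      also have "\<dots> \<le> cmod (z - w) * (cmod (f y) / (\<delta> * \<delta>))"
        using le d by (intro mult_left_mono divide_left_mono mult_mono) (auto intro!: mult_pos_pos)
      finally show ?thesis by (simp add: power2_eq_square)
    qed simp
  qed (use d in auto)
  also have "\<dots> = cmod (z - w) * (integral {-R..R} (\<lambda>y. cmod (f y)) / \<delta>\<^sup>2)" by simp
  also have "integral {-R..R} ?D = of_real pi * (cauchy_int f R z - cauchy_int f R w)"
    unfolding cauchy_int_def diff_divide_distrib[symmetric]
    using integral_diff[OF integrable_cauchy_integrand[OF f d z] integrable_cauchy_integrand[OF f d w]]
    by simp
  finally have "pi * cmod (cauchy_int f R z - cauchy_int f R w)
    \<le> cmod (z - w) * (integral {-R..R} (\<lambda>y. cmod (f y)) / \<delta>\<^sup>2)"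
    by (simp add: norm_mult)
  moreover have "1 * cmod (cauchy_int f R z - cauchy_int f R w) \<le> pi * cmod (cauchy_int f R z - cauchy_int f R w)"
    using pi_gt3 by (intro mult_right_mono) auto
  ultimately show ?thesis by simp
qed

section \<open>Symmetries, holomorphy and the jump across the real line\<close>

lemma cauchy_int_cnj: "cnj (cauchy_int f R z) = cauchy_int (\<lambda>x. cnj (f x)) R (cnj z)"
  unfolding cauchy_int_def by (simp add: Henstock_Kurzweil_Integration.integral_cnj)

lemma cauchy_int_reflect: "cauchy_int (\<lambda>x. f (- x)) R z = - cauchy_int f R (- z)"
proof -
  have "integral {-R..R} (\<lambda>y. f (- y) / (z - of_real y)) = integral {-R..R} (\<lambda>y. f y / (z + of_real y))"
    using Henstock_Kurzweil_Integration.integral_reflect_real[of R "-R" "\<lambda>y. f y / (z + of_real y)"] by simp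
  also have "\<dots> = - integral {-R..R} (\<lambda>y. f y / (- z - of_real y))"
    by (subst integral_neg[symmetric], rule integral_cong) (simp add: minus_divide_right del: integral_neg)
  finally show ?thesis by (simp add: cauchy_int_def)
qed

lemma holomorphic_cauchy_int:
  assumes f: "continuous_on {-R..R} f"
  shows "cauchy_int f R holomorphic_on {z. 0 < Im z}"
proof -
  have nz: "z - of_real y \<noteq> 0" if "0 < Im z" for z y
    using that by (auto simp: complex_eq_iff)
  have "(\<lambda>z. integral (cbox (-R) R) (\<lambda>y. f y / (z - of_real y))) holomorphic_on {z. 0 < Im z}"
  proof (rule leibniz_rule_holomorphic)
    fix z :: complex and t :: real assume "z \<in> {z. 0 < Im z}"
    then have "z - of_real t \<noteq> 0" using nz by auto
    then show "((\<lambda>z. f t / (z - of_real t)) has_field_derivative (- f t / (z - of_real t)\<^sup>2)) (at z within {z. 0 < Im z})"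
      by (auto intro!: derivative_eq_intros simp: power2_eq_square)
  next
    fix z :: complex assume z: "z \<in> {z. 0 < Im z}"
    show "(\<lambda>y. f y / (z - of_real y)) integrable_on cbox (-R) R"
      unfolding box_real
      by (intro integrable_continuous_interval continuous_intros f) (use z nz in auto)
  next
    have cf: "continuous_on ({z. 0 < Im z} \<times> cbox (-R) R) (\<lambda>p. f (snd p))"
      by (rule continuous_on_compose2[OF f]) (auto intro!: continuous_intros)
    show "continuous_on ({z. 0 < Im z} \<times> cbox (-R) R) (\<lambda>(z, y). - f y / (z - of_real y)\<^sup>2)"
      unfolding split_beta by (intro continuous_intros cf) (use nz in auto)
  next
    show "convex {z. 0 < Im z}" using convex_halfspace_Im_gt[of 0] by simp
  qed
  then have "(\<lambda>z. integral {-R..R} (\<lambda>y. f y / (z - of_real y)) / of_real pi) holomorphic_on {z. 0 < Im z}"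
    unfolding box_real by (intro holomorphic_intros) auto
  then show ?thesis unfolding cauchy_int_def[abs_def] .
qed

text \<open>The Cauchy kernels at x + i t and x - i t differ by -2 i pi times the Poisson kernel;
  \<open>prod\<close> computes their common denominator.\<close>

lemma cauchy_int_jump:
  assumes f: "continuous_on {-R..R} f" and "t \<noteq> 0"
  shows "cauchy_int f R (of_real x + \<i> * of_real t) - cauchy_int f R (of_real x - \<i> * of_real t)
    = - 2 * \<i> * poisson_int f R t x"
proof -
  let ?z = "of_real x + \<i> * of_real t" and ?w = "of_real x - \<i> * of_real t"
  have far: "\<bar>t\<bar> \<le> cmod (?z - of_real y)" "\<bar>t\<bar> \<le> cmod (?w - of_real y)" for y
    using Im_le_dist_real[of ?z y] Im_le_dist_real[of ?w y] by simp_all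
  have t: "\<bar>t\<bar> > 0" using assms by simp
  have "cauchy_int f R ?z - cauchy_int f R ?w
      = integral {-R..R} (\<lambda>y. f y / (?z - of_real y) - f y / (?w - of_real y)) / of_real pi"
    unfolding cauchy_int_def diff_divide_distrib[symmetric]
    using integral_diff[OF integrable_cauchy_integrand[OF f t far(1)] integrable_cauchy_integrand[OF f t far(2)]]
    by simp
  also have "\<dots> = integral {-R..R} (\<lambda>y. (- 2 * \<i> * of_real pi) * (of_real (poisson_kernel t (x - y)) * f y)) / of_real pi"
  proof (intro arg_cong2[where f = "(/)"] integral_cong refl)
    fix y
    have nz: "?z - of_real y \<noteq> 0" "?w - of_real y \<noteq> 0" using far[of y] t by auto
    have prod: "(?z - of_real y) * (?w - of_real y) = of_real ((x - y)\<^sup>2 + t\<^sup>2)"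
      by (simp add: algebra_simps power2_eq_square)
    have "f y / (?z - of_real y) - f y / (?w - of_real y)
      = f y * (- 2 * \<i> * of_real t) / ((?z - of_real y) * (?w - of_real y))"
      using nz by (simp add: field_simps)
    also have "\<dots> = (- 2 * \<i> * of_real pi) * (of_real (poisson_kernel t (x - y)) * f y)"
      unfolding prod poisson_kernel_def by simp
    finally show "f y / (?z - of_real y) - f y / (?w - of_real y)
      = (- 2 * \<i> * of_real pi) * (of_real (poisson_kernel t (x - y)) * f y)" .
  qed
  also have "\<dots> = - 2 * \<i> * poisson_int f R t x"
    unfolding poisson_int_def by simp
  finally show ?thesis .
qed

section \<open>L2 bounds on horizontal lines, by Cauchy's theorem\<close>

lemma horizontal_integral_decay:
  assumes hol: "H holomorphic_on {z. 0 < Im z}" and "\<eta> > 0" "T > 0" "C \<ge> 0"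
    and decay: "\<And>z. 0 < Im z \<Longrightarrow> T / 2 \<le> cmod z \<Longrightarrow> cmod (H z) \<le> C / (cmod z)\<^sup>2"
  shows "cmod (integral {-T..T} (\<lambda>x. H (of_real x + \<i> * of_real \<eta>))) \<le> 16 * C / T"
proof -
  define G where "G = (\<lambda>z. H (z + \<i> * of_real \<eta>))"
  have holG: "G holomorphic_on {z. - \<eta> < Im z}"
    unfolding G_def
    by (rule holomorphic_on_compose_gen[of "\<lambda>z. z + \<i> * of_real \<eta>" _ H, OF _ hol, unfolded o_def])
      (auto intro!: holomorphic_intros)
  \<comment> \<open>The contour is the triangle with vertices -T, T and i T. Each slanted side has
    length at most 2 T and carries |G| \<le> 4 C / T^2, so the base contributes at most 16 C /
    T.\<close>
  let ?a = "of_real (- T) :: complex" and ?b = "of_real T :: complex" and ?c = "\<i> * of_real T"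
  have hull: "convex hull {?a, ?b, ?c} \<subseteq> {z. 0 \<le> Im z}"
    by (rule hull_minimal) (use \<open>T > 0\<close> convex_halfspace_Im_ge[of 0] in auto)
  also have "\<dots> \<subseteq> {z. - \<eta> < Im z}" using \<open>\<eta> > 0\<close> by auto
  finally have holT: "G holomorphic_on convex hull {?a, ?b, ?c}"
    by (rule holomorphic_on_subset[OF holG])
  have contG: "continuous_on (closed_segment p q) G" if "p \<in> {?a,?b,?c}" "q \<in> {?a,?b,?c}" for p q
    by (rule continuous_on_subset[OF holomorphic_on_imp_continuous_on[OF holT]])
      (use that in \<open>auto simp: segment_convex_hull intro!: hull_mono\<close>)
  have tri: "contour_integral (linepath ?a ?b) G + contour_integral (linepath ?b ?c) G
      + contour_integral (linepath ?c ?a) G = 0"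
  proof -
    have "(G has_contour_integral 0) (linepath ?a ?b +++ linepath ?b ?c +++ linepath ?c ?a)"
      by (rule Cauchy_theorem_triangle[OF holT])
    then have "contour_integral (linepath ?a ?b +++ linepath ?b ?c +++ linepath ?c ?a) G = 0"
      by (rule contour_integral_unique)
    then show ?thesis
      by (subst (asm) contour_integral_join contour_integrable_joinI;
          simp add: contour_integrable_continuous_linepath contG add.assoc)+
  qed
  have side: "cmod (contour_integral (linepath p q) G) \<le> 4 * C / T\<^sup>2 * cmod (q - p)"
    if pq: "p \<in> {?a,?b,?c}" "q \<in> {?a,?b,?c}" and far: "\<And>z. z \<in> closed_segment p q \<Longrightarrow> T / 2 \<le> cmod z" for p q
  proof (rule contour_integral_bound_linepath)
    show "G contour_integrable_on linepath p q"
      by (rule contour_integrable_continuous_linepath[OF contG[OF pq]])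
    show "0 \<le> 4 * C / T\<^sup>2" using \<open>C \<ge> 0\<close> by simp
    fix z assume z: "z \<in> closed_segment p q"
    then have "z \<in> convex hull {?a, ?b, ?c}"
      using pq unfolding segment_convex_hull by (meson hull_mono subsetD insert_subset empty_subsetI)
    then have im: "0 \<le> Im z" using hull by auto
    have "cmod z \<le> cmod (z + \<i> * of_real \<eta>)"
      using im \<open>\<eta> > 0\<close> by (simp add: cmod_def power_mono)
    with far[OF z] have fz: "T / 2 \<le> cmod (z + \<i> * of_real \<eta>)" by linarith
    have "cmod (G z) \<le> C / (cmod (z + \<i> * of_real \<eta>))\<^sup>2"
      unfolding G_def using im \<open>\<eta> > 0\<close> fz by (intro decay) auto
    also have "\<dots> \<le> C / (T / 2)\<^sup>2"
      using \<open>C \<ge> 0\<close> \<open>T > 0\<close> fz by (intro divide_left_mono power_mono mult_pos_pos zero_less_power) auto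
    finally show "cmod (G z) \<le> 4 * C / T\<^sup>2" by (simp add: power_divide mult.commute)
  qed
  \<comment> \<open>Both slanted sides lie on |Re z| + Im z = T, so one summand is at least T / 2.
    Real parts of equal sign at the endpoints make |Re| affine along the segment.\<close>
  have seg: "T / 2 \<le> cmod z" if "z \<in> closed_segment p q" "\<bar>Re p\<bar> + Im p = T" "Im p \<ge> 0"
     "\<bar>Re q\<bar> + Im q = T" "Im q \<ge> 0" "Re p * Re q \<ge> 0" for z p q
  proof -
    from that(1) obtain u where u: "0 \<le> u" "u \<le> 1" "z = (1 - u) *\<^sub>R p + u *\<^sub>R q"
      by (auto simp: in_segment)
    have "\<bar>Re z\<bar> = (1 - u) * \<bar>Re p\<bar> + u * \<bar>Re q\<bar>"
    proof -
      have "0 \<le> ((1 - u) * Re p) * (u * Re q)"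
        using u that(6) by (metis mult.commute mult.left_commute mult_nonneg_nonneg diff_ge_0_iff_ge)
      then have "\<bar>(1 - u) * Re p + u * Re q\<bar> = \<bar>(1 - u) * Re p\<bar> + \<bar>u * Re q\<bar>"
        by (auto simp: zero_le_mult_iff)
      then show ?thesis using u by (simp add: abs_mult)
    qed
    moreover have "Im z = (1 - u) * Im p + u * Im q" using u(3) by simp
    ultimately have "\<bar>Re z\<bar> + Im z = (1 - u) * (\<bar>Re p\<bar> + Im p) + u * (\<bar>Re q\<bar> + Im q)"
      by (simp add: algebra_simps)
    also have "\<dots> = T" using that by (simp add: algebra_simps)
    finally show ?thesis using abs_Re_le_cmod[of z] abs_Im_le_cmod[of z] by linarith
  qed
  have nTT: "cmod (?c - ?b) \<le> 2 * T" "cmod (?a - ?c) \<le> 2 * T"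
    using norm_triangle_ineq4[of ?c ?b] norm_triangle_ineq4[of ?a ?c] \<open>T > 0\<close> by (simp_all add: norm_mult)
  have "cmod (contour_integral (linepath ?b ?c) G) \<le> 4 * C / T\<^sup>2 * cmod (?c - ?b)"
    by (rule side) (use seg[of _ ?b ?c] \<open>T > 0\<close> in auto)
  also have "\<dots> \<le> 4 * C / T\<^sup>2 * (2 * T)" using nTT \<open>C \<ge> 0\<close> by (intro mult_left_mono) auto
  finally have 1: "cmod (contour_integral (linepath ?b ?c) G) \<le> 8 * C / T"
    using \<open>T > 0\<close> by (simp add: power2_eq_square)
  have "cmod (contour_integral (linepath ?c ?a) G) \<le> 4 * C / T\<^sup>2 * cmod (?a - ?c)"
    by (rule side) (use seg[of _ ?c ?a] \<open>T > 0\<close> in auto)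
  also have "\<dots> \<le> 4 * C / T\<^sup>2 * (2 * T)" using nTT \<open>C \<ge> 0\<close> by (intro mult_left_mono) auto
  finally have 2: "cmod (contour_integral (linepath ?c ?a) G) \<le> 8 * C / T"
    using \<open>T > 0\<close> by (simp add: power2_eq_square)
  have "contour_integral (linepath ?a ?b) G = integral {-T..T} (\<lambda>x. H (of_real x + \<i> * of_real \<eta>))"
  proof -
    have "(G has_contour_integral contour_integral (linepath ?a ?b) G) (linepath ?a ?b)"
      by (intro has_contour_integral_integral contour_integrable_continuous_linepath contG) auto
    then show ?thesis
      using \<open>T > 0\<close> by (subst (asm) has_contour_integral_linepath_Reals_iff)
        (auto simp: G_def integral_unique)
  qed
  then have "cmod (integral {-T..T} (\<lambda>x. H (of_real x + \<i> * of_real \<eta>)))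
      = cmod (contour_integral (linepath ?b ?c) G + contour_integral (linepath ?c ?a) G)"
    using tri by (metis add.assoc add_eq_0_iff norm_minus_cancel)
  also have "\<dots> \<le> 8 * C / T + 8 * C / T" using 1 2 norm_triangle_mono by blast
  finally show ?thesis by simp
qed

lemma continuous_on_cauchy_int_horizontal:
  assumes f: "continuous_on {-R..R} f" and "t \<noteq> 0"
  shows "continuous_on S (\<lambda>x. cauchy_int f R (of_real x + \<i> * of_real t))"
proof -
  let ?K = "integral {-R..R} (\<lambda>y. cmod (f y)) / \<bar>t\<bar>\<^sup>2"
  let ?F = "\<lambda>x. cauchy_int f R (of_real x + \<i> * of_real t)"
  have K0: "?K \<ge> 0" by (intro divide_nonneg_nonneg integral_nonneg integrable_continuous_interval continuous_intros f) auto
  have "?K-lipschitz_on S ?F"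
  proof (rule lipschitz_onI[OF _ K0])
    fix x x' :: real
    have "cmod (?F x - ?F x') \<le> cmod ((of_real x + \<i> * of_real t) - (of_real x' + \<i> * of_real t)) * ?K"
      using assms Im_le_dist_real[of "of_real x + \<i> * of_real t"] Im_le_dist_real[of "of_real x' + \<i> * of_real t"]
      by (intro cauchy_int_Lipschitz[OF f]) auto
    also have "cmod ((of_real x + \<i> * of_real t) - (of_real x' + \<i> * of_real t)) = cmod (of_real (x - x'))" by simp
    finally show "dist (?F x) (?F x') \<le> ?K * dist x x'" by (simp only: dist_norm norm_of_real) (simp add: mult.commute)
  qed
  then show ?thesis by (rule lipschitz_on_continuous_on)
qed

text \<open>The boundary values from above and below are orthogonal in \<open>L\<^sup>2\<close>, because
  \<open>F\<^sub>f(x + i\<eta>) \<cdot> cnj (F\<^sub>f(x - i\<eta>)) = F\<^sub>f(x + i\<eta>) \<cdot> F\<^bsub>cnj f\<^esub>(x + i\<eta>)\<close> extends holomorphically to the upper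
  half-plane. Hence their norms are controlled by that of their difference, a Poisson integral.\<close>
lemma cauchy_int_L2:
  assumes f: "continuous_on {-R..R} f" and "R > 0" "\<eta> > 0"
  shows "integral {a..b} (\<lambda>x. (cmod (cauchy_int f R (of_real x + \<i> * of_real \<eta>)))\<^sup>2)
    \<le> 4 * integral {-R..R} (\<lambda>x. (cmod (f x))\<^sup>2)"
proof -
  define N where "N = integral {-R..R} (\<lambda>x. (cmod (f x))\<^sup>2)"
  define L where "L = integral {-R..R} (\<lambda>x. cmod (f x))"
  define F where "F = (\<lambda>x. cauchy_int f R (of_real x + \<i> * of_real \<eta>))"
  define D where "D = (\<lambda>x. cauchy_int f R (of_real x - \<i> * of_real \<eta>))"
  define g where "g = (\<lambda>x. cnj (f x))"
  define H where "H = (\<lambda>z. cauchy_int f R z * cauchy_int g R z)"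
  have g: "continuous_on {-R..R} g" unfolding g_def by (intro continuous_intros f)
  have Lg: "integral {-R..R} (\<lambda>x. cmod (g x)) = L" by (simp add: g_def L_def)
  have L0: "L \<ge> 0" unfolding L_def by (intro integral_nonneg integrable_continuous_interval continuous_intros f) auto
  have contF: "continuous_on S F" for S unfolding F_def
    using \<open>\<eta> > 0\<close> by (intro continuous_on_cauchy_int_horizontal f) auto
  have contD: "continuous_on S D" for S unfolding D_def
    using \<open>\<eta> > 0\<close> continuous_on_cauchy_int_horizontal[OF f, of "-\<eta>" S] by simp
  have cnjD: "H (of_real x + \<i> * of_real \<eta>) = F x * cnj (D x)" for x
    by (simp add: H_def F_def D_def g_def cauchy_int_cnj)
  have contP: "continuous_on S (poisson_int f R \<eta>)" for S
  proof -
    have "poisson_int f R \<eta> = (\<lambda>x. (F x - D x) / (- 2 * \<i>))"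
      using cauchy_int_jump[OF f, of \<eta>] \<open>\<eta> > 0\<close> by (auto simp: F_def D_def fun_eq_iff)
    then show ?thesis by (auto intro!: continuous_intros contF contD)
  qed
  \<comment> \<open>Expand |F - D|^2 and drop |D|^2. The jump relation turns F - D into the Poisson
    integral, and the cross term is H by \<open>cnjD\<close>.\<close>
  have pt: "(cmod (F x))\<^sup>2 \<le> 4 * (cmod (poisson_int f R \<eta> x))\<^sup>2 + 2 * Re (H (of_real x + \<i> * of_real \<eta>))" for x
  proof -
    have "F x - D x = - 2 * \<i> * poisson_int f R \<eta> x"
      using cauchy_int_jump[OF f, of \<eta> x] \<open>\<eta> > 0\<close> by (simp add: F_def D_def)
    then have "4 * (cmod (poisson_int f R \<eta> x))\<^sup>2 = (cmod (F x - D x))\<^sup>2"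
      by (simp add: norm_mult power_mult_distrib)
    moreover have "(cmod (F x - D x))\<^sup>2 + 2 * Re (F x * cnj (D x)) = (cmod (F x))\<^sup>2 + (cmod (D x))\<^sup>2"
      unfolding cmod_power2 by (simp add: power2_eq_square algebra_simps)
    ultimately show ?thesis unfolding cnjD using zero_le_power2[of "cmod (D x)"] by linarith
  qed
  have holH: "H holomorphic_on {z. 0 < Im z}"
    unfolding H_def by (intro holomorphic_intros holomorphic_cauchy_int f g)
  \<comment> \<open>On |z| \<ge> T / 2 \<ge> 2 R both Cauchy integrals are at most 2 L / |z|, so H
    is at most 4 L^2 / |z|^2 there and its integral over [-T, T] is O(1 / T). Afterwards T tends to
    infinity.\<close>
  have big: "integral {a..b} (\<lambda>x. (cmod (F x))\<^sup>2) \<le> 4 * N + 128 * L\<^sup>2 / T"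
    if T: "T \<ge> 4 * R" "T \<ge> \<bar>a\<bar>" "T \<ge> \<bar>b\<bar>" for T
  proof -
    have "T > 0" using T \<open>R > 0\<close> by linarith
    have "integral {a..b} (\<lambda>x. (cmod (F x))\<^sup>2) \<le> integral {-T..T} (\<lambda>x. (cmod (F x))\<^sup>2)"
      by (intro integral_subset_le integrable_continuous_interval continuous_intros contF) (use T in auto)
    also have "\<dots> \<le> integral {-T..T} (\<lambda>x. 4 * (cmod (poisson_int f R \<eta> x))\<^sup>2 + 2 * Re (H (of_real x + \<i> * of_real \<eta>)))"
      by (intro integral_le integrable_continuous_interval continuous_intros contF contP pt)
        (auto simp: cnjD intro!: continuous_intros contF contD)
    also have "\<dots> = 4 * integral {-T..T} (\<lambda>x. (cmod (poisson_int f R \<eta> x))\<^sup>2)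
        + 2 * Re (integral {-T..T} (\<lambda>x. H (of_real x + \<i> * of_real \<eta>)))"
    proof -
      have iH: "(\<lambda>x. H (of_real x + \<i> * of_real \<eta>)) integrable_on {-T..T}"
        unfolding cnjD by (intro integrable_continuous_interval continuous_intros contF contD)
      have iP: "(\<lambda>x. (cmod (poisson_int f R \<eta> x))\<^sup>2) integrable_on {-T..T}"
        by (intro integrable_continuous_interval continuous_intros contP)
      show ?thesis
        by (intro integral_unique has_integral_add has_integral_mult_right integrable_integral iP has_integral_Re iH)
    qed
    also have "\<dots> \<le> 4 * N + 2 * (16 * (4 * L\<^sup>2) / T)"
    proof (intro add_mono mult_left_mono)
      show "integral {-T..T} (\<lambda>x. (cmod (poisson_int f R \<eta> x))\<^sup>2) \<le> N"
        unfolding N_def by (rule poisson_int_L2[OF f \<open>\<eta> > 0\<close>])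
      have "cmod (integral {-T..T} (\<lambda>x. H (of_real x + \<i> * of_real \<eta>))) \<le> 16 * (4 * L\<^sup>2) / T"
      proof (rule horizontal_integral_decay[OF holH \<open>\<eta> > 0\<close> \<open>T > 0\<close>])
        fix z assume z: "T / 2 \<le> cmod z"
        then have zR: "cmod z > R" "cmod z - R \<ge> cmod z / 2" using T \<open>R > 0\<close> by auto
        have "L / (cmod z - R) \<le> L / (cmod z / 2)"
          using L0 zR \<open>R > 0\<close> by (intro divide_left_mono mult_pos_pos) auto
        then have "cmod (cauchy_int f R z) \<le> 2 * L / cmod z" "cmod (cauchy_int g R z) \<le> 2 * L / cmod z"
          using norm_cauchy_int_far[OF f \<open>R > 0\<close> zR(1)] norm_cauchy_int_far[OF g \<open>R > 0\<close> zR(1)] Lg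
          by (simp_all add: L_def mult.commute)
        then have "cmod (H z) \<le> (2 * L / cmod z) * (2 * L / cmod z)"
          unfolding H_def norm_mult using L0 by (intro mult_mono) auto
        then show "cmod (H z) \<le> 4 * L\<^sup>2 / (cmod z)\<^sup>2" by (simp add: power2_eq_square)
      qed simp
      then show "Re (integral {-T..T} (\<lambda>x. H (of_real x + \<i> * of_real \<eta>))) \<le> 16 * (4 * L\<^sup>2) / T"
        using complex_Re_le_cmod order_trans by blast
    qed auto
    finally show ?thesis by simp
  qed
  have "((\<lambda>T. 4 * N + 128 * L\<^sup>2 / T) \<longlongrightarrow> 4 * N + 0) at_top"
    by (intro tendsto_add tendsto_const tendsto_divide_0[OF tendsto_const] filterlim_at_top_imp_at_infinity filterlim_ident)
  moreover have "\<forall>\<^sub>F T in at_top. integral {a..b} (\<lambda>x. (cmod (F x))\<^sup>2) \<le> 4 * N + 128 * L\<^sup>2 / T"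
    using eventually_ge_at_top[of "max (4 * R) (max \<bar>a\<bar> \<bar>b\<bar>)"] by eventually_elim (auto intro: big)
  ultimately have "integral {a..b} (\<lambda>x. (cmod (F x))\<^sup>2) \<le> 4 * N + 0"
    by (rule tendsto_lowerbound) simp
  then show ?thesis by (simp add: F_def N_def)
qed

subsection \<open>A two-constants theorem in the half-plane\<close>

text \<open>For \<open>Im z > 0\<close> the real part of this function is harmonic; its boundary values are
  \<open>sqrt (r\<^sup>2 - s\<^sup>2)\<close> on \<open>[-r, r]\<close> and \<open>0\<close> elsewhere on the real line. It replaces the harmonic measure of
  \<open>[-r, r]\<close> in the two-constants theorem.\<close>
definition barrier :: "real \<Rightarrow> complex \<Rightarrow> complex" where
  "barrier r z = csqrt ((of_real r)\<^sup>2 - z\<^sup>2) + \<i> * z"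

declare csqrt.simps [simp del]

lemma csqrt_Re_Im:
  "(Re (csqrt w))\<^sup>2 - (Im (csqrt w))\<^sup>2 = Re w" "2 * Re (csqrt w) * Im (csqrt w) = Im w"
  by (metis Re_power2 power2_csqrt) (metis Im_power2 power2_csqrt)

lemma Re_csqrt_power2: "2 * (Re (csqrt w))\<^sup>2 = cmod w + Re w"
proof -
  have "cmod w = (Re (csqrt w))\<^sup>2 + (Im (csqrt w))\<^sup>2"
    by (metis cmod_power2 norm_power power2_csqrt)
  then show ?thesis using csqrt_Re_Im(1)[of w] by simp
qed

text \<open>For p = Re (csqrt w), the identity 2 p^2 = |w| + Re w yields p \<le> r + Im z; the
  summand i z takes the Im z away again.\<close>

lemma Re_barrier_le:
  assumes "r \<ge> 0" "Im z \<ge> 0"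
  shows "Re (barrier r z) \<le> r"
proof -
  let ?w = "(of_real r)\<^sup>2 - z\<^sup>2 :: complex"
  have "cmod ?w \<le> cmod ((of_real r)\<^sup>2) + cmod (z\<^sup>2)" by (rule norm_triangle_ineq4)
  then have "cmod ?w \<le> r\<^sup>2 + ((Re z)\<^sup>2 + (Im z)\<^sup>2)" by (simp add: norm_power cmod_power2)
  moreover have "Re ?w = r\<^sup>2 - ((Re z)\<^sup>2 - (Im z)\<^sup>2)" by (simp add: Re_power2)
  ultimately have "2 * (Re (csqrt ?w))\<^sup>2 \<le> 2 * (r\<^sup>2 + (Im z)\<^sup>2)"
    unfolding Re_csqrt_power2 by simp
  also have "\<dots> \<le> 2 * (r + Im z)\<^sup>2" using assms by (simp add: power2_sum)
  finally have "(Re (csqrt ?w))\<^sup>2 \<le> (r + Im z)\<^sup>2" by simp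
  then have "Re (csqrt ?w) \<le> r + Im z" by (rule power2_le_imp_le) (use assms in simp)
  then show ?thesis by (simp add: barrier_def)
qed

text \<open>Stated at height \<delta> because the real points beyond r are sent to the branch cut of
  \<open>csqrt\<close>. With p + i q the root, q^2 is at least s^2 / 2, so p q = -s \<delta> forces
  p to be of order \<delta>.\<close>

lemma Re_barrier_le_outside:
  assumes "0 < \<delta>" "\<delta> \<le> r" "2 * r \<le> \<bar>s\<bar>"
  shows "Re (barrier r (of_real s + \<i> * of_real \<delta>)) \<le> 2 * \<delta>"
proof -
  let ?w = "(of_real r)\<^sup>2 - (of_real s + \<i> * of_real \<delta>)\<^sup>2 :: complex"
  define p q where "p = Re (csqrt ?w)" and "q = Im (csqrt ?w)"
  have re: "p\<^sup>2 - q\<^sup>2 = r\<^sup>2 - s\<^sup>2 + \<delta>\<^sup>2" and im: "p * q = - (s * \<delta>)"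
    using csqrt_Re_Im[of ?w] unfolding p_def q_def by (simp_all add: Re_power2 Im_power2 mult.commute)
  have "\<delta>\<^sup>2 \<le> r\<^sup>2" using assms by (intro power_mono) auto
  moreover have "4 * r\<^sup>2 \<le> s\<^sup>2" using assms power_mono[of "2 * r" "\<bar>s\<bar>" 2] by simp
  ultimately have "s\<^sup>2 / 2 \<le> q\<^sup>2" using re zero_le_power2[of p] by linarith
  then have "p\<^sup>2 * (s\<^sup>2 / 2) \<le> p\<^sup>2 * q\<^sup>2" by (intro mult_left_mono) auto
  also have "\<dots> = s\<^sup>2 * \<delta>\<^sup>2" using im by (metis power_mult_distrib power2_minus)
  finally have "s\<^sup>2 * p\<^sup>2 \<le> s\<^sup>2 * (2 * \<delta>\<^sup>2)" by (simp add: mult.commute mult.left_commute)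
  moreover have "s\<^sup>2 > 0" using assms by auto
  ultimately have "p\<^sup>2 \<le> 2 * \<delta>\<^sup>2" by (simp only: mult_le_cancel_left_pos)
  also have "\<dots> \<le> (2 * \<delta>)\<^sup>2" by (simp add: power_mult_distrib)
  finally have "p \<le> 2 * \<delta>" by (rule power2_le_imp_le) (use assms in simp)
  then show ?thesis using assms by (simp add: barrier_def p_def)
qed

text \<open>Linear growth in the height b is the source of the gain exp (c A \<tau>). If p were
  below (1 + r^2 / 15) b, the equation for p^2 - q^2 would give q^2 < 1 - m, while p^2 < (1 + m)
  b^2; but then b^2 = p^2 q^2 would be less than (1 - m^2) b^2.\<close>

lemma Re_barrier_ge:
  assumes "0 < r" "r \<le> 1" "0 < b" "b \<le> 2"
  shows "r\<^sup>2 / 15 * b \<le> Re (barrier r (1 + \<i> * of_real b))"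
proof -
  let ?w = "(of_real r)\<^sup>2 - (1 + \<i> * of_real b)\<^sup>2 :: complex"
  define p q where "p = Re (csqrt ?w)" and "q = Im (csqrt ?w)"
  \<comment> \<open>The constant 15 is chosen so that 5 m \<le> r^2, which absorbs the term m b^2
    \<le> 4 m together with one further m.\<close>
  define m where "m = (1 + r\<^sup>2 / 15)\<^sup>2 - 1"
  have re: "p\<^sup>2 - q\<^sup>2 = r\<^sup>2 - 1 + b\<^sup>2" and im: "p * q = - b"
    using csqrt_Re_Im[of ?w] unfolding p_def q_def by (simp_all add: Re_power2 Im_power2 mult.commute)
  have p0: "p > 0" using im assms Re_csqrt[of ?w] unfolding p_def[symmetric]
    by (metis less_eq_real_def mult_zero_left neg_equal_0_iff_equal order_less_irrefl)
  have r1: "r\<^sup>2 \<le> 1" using assms by (simp add: power_le_one)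
  have "r\<^sup>2 / 15 * (r\<^sup>2 / 15) \<le> r\<^sup>2 / 15 * 1" using r1 by (intro mult_left_mono) auto
  then have m: "m \<le> r\<^sup>2 / 5" unfolding m_def by (simp add: power2_eq_square algebra_simps)
  have m0: "0 < m" unfolding m_def using assms by (simp add: power2_eq_square algebra_simps add_pos_pos)
  have "(1 + r\<^sup>2 / 15) * b \<le> p"
  proof (rule ccontr)
    assume "\<not> (1 + r\<^sup>2 / 15) * b \<le> p"
    then have "p\<^sup>2 < ((1 + r\<^sup>2 / 15) * b)\<^sup>2" using p0 by (intro power_strict_mono) auto
    then have pm: "p\<^sup>2 < (1 + m) * b\<^sup>2" by (simp add: m_def power_mult_distrib)
    have b: "b\<^sup>2 = p\<^sup>2 * q\<^sup>2" using im by (metis power_mult_distrib power2_minus)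
    have "b\<^sup>2 \<le> 4" using assms power_mono[of b 2 2] by simp
    then have "m * b\<^sup>2 \<le> m * 4" using m0 by (intro mult_left_mono) auto
    then have q: "q\<^sup>2 < 1 - r\<^sup>2 + 4 * m" using pm re by (simp add: algebra_simps)
    have q': "q\<^sup>2 < 1 - m" using q m by simp
    have "b\<^sup>2 \<le> (1 + m) * b\<^sup>2 * q\<^sup>2" unfolding b[symmetric]
      by (subst (1) b) (intro mult_right_mono, use pm in auto)
    also have "\<dots> \<le> (1 + m) * b\<^sup>2 * (1 - m)" using q' m0 by (intro mult_left_mono) auto
    also have "\<dots> = b\<^sup>2 - m\<^sup>2 * b\<^sup>2" by (simp add: algebra_simps power2_eq_square)
    also have "\<dots> < b\<^sup>2" using m0 assms by simp
    finally show False by simp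
  qed
  then show ?thesis by (simp add: barrier_def p_def algebra_simps)
qed

text \<open>In the upper half-plane r^2 - z^2 avoids the branch cut: a real value forces Re z = 0,
  and then the value is r^2 + (Im z)^2 > 0.\<close>

lemma holomorphic_barrier:
  assumes "r > 0"
  shows "barrier r holomorphic_on {z. 0 < Im z}"
proof -
  have "(of_real r)\<^sup>2 - z\<^sup>2 \<notin> \<real>\<^sub>\<le>\<^sub>0" if z: "0 < Im z" for z :: complex
  proof
    assume "(of_real r)\<^sup>2 - z\<^sup>2 \<in> \<real>\<^sub>\<le>\<^sub>0"
    then have "r\<^sup>2 - ((Re z)\<^sup>2 - (Im z)\<^sup>2) \<le> 0" "Re z * Im z = 0"
      by (auto simp: complex_nonpos_Reals_iff Re_power2 Im_power2)
    moreover have "0 < r\<^sup>2 + (Im z)\<^sup>2" using assms by (simp add: add_pos_nonneg)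
    ultimately show False using z by simp
  qed
  then show ?thesis unfolding barrier_def[abs_def] by (intro holomorphic_intros) auto
qed

text \<open>Maximum principle for z h(z)^2 exp (A * barrier) on a large half-disc. The modulus of z
  h(z)^2 is the quantity bounded on the real line. The exponential costs at most exp (A r) on
  [-2 r, 2 r] and almost nothing beyond, and gains exp (A r^2 \<tau> / 15) at 1 + i \<tau>. The
  switch is at 2 r because the barrier is shown to be small only from there on.\<close>

lemma two_constants_half_plane:
  fixes h :: "complex \<Rightarrow> complex"
  assumes hol: "h holomorphic_on {z. - \<kappa> < Im z}" and "\<kappa> > 0"
    and decay: "\<And>z. 0 \<le> Im z \<Longrightarrow> \<rho>0 \<le> cmod z \<Longrightarrow> cmod z * (cmod (h z))\<^sup>2 \<le> C / cmod z"
    and inside: "\<And>s. \<bar>s\<bar> \<le> 2 * r \<Longrightarrow> \<bar>s\<bar> * (cmod (h (of_real s)))\<^sup>2 \<le> B1"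
    and outside: "\<And>s. 2 * r \<le> \<bar>s\<bar> \<Longrightarrow> \<bar>s\<bar> * (cmod (h (of_real s)))\<^sup>2 \<le> B2"
    and B: "0 \<le> B1" "0 \<le> B2" and r: "0 < r" "r \<le> 1" and "A \<ge> 0" and \<tau>: "0 < \<tau>" "\<tau> \<le> 1"
  shows "(cmod (h (1 + \<i> * of_real \<tau>)))\<^sup>2 * exp (A * (r\<^sup>2 / 15) * \<tau>) \<le> B1 * exp (A * r) + B2"
proof -
  define X where "X = (cmod (h (1 + \<i> * of_real \<tau>)))\<^sup>2 * exp (A * (r\<^sup>2 / 15) * \<tau>)"
  have main: "X \<le> B1 * exp (A * r) + B2 * exp (A * (2 * \<delta>)) + \<delta>" if \<delta>: "0 < \<delta>" "\<delta> \<le> r" for \<delta>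
  proof -
    \<comment> \<open>Raising the argument of the barrier by i \<delta> makes \<psi> holomorphic
      near the closed half-plane; \<delta> tends to 0 at the end.\<close>
    define \<psi> where "\<psi> = (\<lambda>z. z * (h z)\<^sup>2 * exp (of_real A * barrier r (z + \<i> * of_real \<delta>)))"
    \<comment> \<open>The radius is so large that the decay of h pushes \<psi> below \<delta> on the
      arc, and it is at least 2 so that 1 + i \<tau> lies in the half-disc.\<close>
    define \<rho> where "\<rho> = max \<rho>0 (max 2 (\<bar>C\<bar> * exp (A * r) / \<delta>))"
    define S where "S = cball 0 \<rho> \<inter> {z::complex. 0 \<le> Im z}"
    let ?B = "B1 * exp (A * r) + B2 * exp (A * (2 * \<delta>)) + \<delta>"
    have \<rho>: "\<rho>0 \<le> \<rho>" "2 \<le> \<rho>" "\<bar>C\<bar> * exp (A * r) / \<delta> \<le> \<rho>" by (auto simp: \<rho>_def)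
    have norm_psi: "cmod (\<psi> z) = cmod z * (cmod (h z))\<^sup>2 * exp (A * Re (barrier r (z + \<i> * of_real \<delta>)))" for z
      by (simp add: \<psi>_def norm_mult norm_power)
    have holb: "(\<lambda>z. barrier r (z + \<i> * of_real \<delta>)) holomorphic_on {z. 0 \<le> Im z}"
      by (rule holomorphic_on_compose_gen[of "\<lambda>z. z + \<i> * of_real \<delta>", OF _ holomorphic_barrier[OF r(1)], unfolded o_def])
        (use \<delta> in \<open>auto intro!: holomorphic_intros\<close>)
    have holh: "h holomorphic_on {z. 0 \<le> Im z}"
      by (rule holomorphic_on_subset[OF hol]) (use \<open>\<kappa> > 0\<close> in auto)
    have hol\<psi>: "\<psi> holomorphic_on {z. 0 \<le> Im z}"
      unfolding \<psi>_def by (intro holomorphic_intros holb holh)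
    have "closed S" unfolding S_def using closed_halfspace_Im_ge[of 0] by (intro closed_Int) auto
    have bd: "cmod (\<psi> z) \<le> ?B" if z: "z \<in> frontier S" for z
    proof -
      have zS: "z \<in> S" using z \<open>closed S\<close> by (auto simp: frontier_def)
      have "ball 0 \<rho> \<inter> {z. 0 < Im z} \<subseteq> interior S"
        by (rule interior_maximal) (use open_halfspace_Im_gt[of 0] in \<open>auto simp: S_def\<close>)
      moreover have "z \<notin> interior S" using z by (simp add: frontier_def)
      ultimately have "z \<notin> ball 0 \<rho> \<inter> {z. 0 < Im z}" by blast
      then have "cmod z = \<rho> \<or> Im z = 0" using zS by (auto simp: S_def)
      then consider "cmod z = \<rho>" | s where "z = of_real s" "\<bar>s\<bar> \<le> 2 * r" | s where "z = of_real s" "2 * r \<le> \<bar>s\<bar>"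
        by (metis complex_eq_iff Im_complex_of_real Re_complex_of_real linear)
      then show ?thesis
      proof cases
        case 1
        have im: "0 \<le> Im z" using zS by (simp add: S_def)
        have dz: "cmod z * (cmod (h z))\<^sup>2 \<le> C / \<rho>" using decay[of z] 1 im \<rho> by simp
        moreover have "0 \<le> C / \<rho>" using dz by (rule order_trans[rotated]) auto
        ultimately have "cmod (\<psi> z) \<le> (C / \<rho>) * exp (A * r)"
          unfolding norm_psi using im \<open>A \<ge> 0\<close> r \<delta>
          by (intro mult_mono) (auto intro!: mult_left_mono Re_barrier_le)
        also have "\<dots> \<le> \<bar>C\<bar> * exp (A * r) / \<rho>" using \<rho> by (simp add: divide_right_mono mult_right_mono)
        also have "\<dots> \<le> \<delta>" using \<rho> \<delta> by (simp add: field_simps)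
        also have "\<dots> \<le> ?B" using B by simp
        finally show ?thesis .
      next
        case (2 s)
        have "cmod (\<psi> z) \<le> B1 * exp (A * r)"
          unfolding norm_psi using 2 inside[of s] B \<open>A \<ge> 0\<close> r \<delta>
          by (intro mult_mono) (auto intro!: mult_left_mono Re_barrier_le)
        also have "\<dots> \<le> ?B" using B \<delta> by simp
        finally show ?thesis .
      next
        case (3 s)
        have "cmod (\<psi> z) \<le> B2 * exp (A * (2 * \<delta>))"
          unfolding norm_psi using 3 outside[of s] B \<open>A \<ge> 0\<close> r \<delta>
          by (intro mult_mono) (auto intro!: mult_left_mono Re_barrier_le_outside)
        also have "\<dots> \<le> ?B" using B \<delta> by simp
        finally show ?thesis .
      qed
    qed
    let ?\<zeta> = "1 + \<i> * of_real \<tau> :: complex"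
    have n\<zeta>: "1 \<le> cmod ?\<zeta>" "cmod ?\<zeta> \<le> 2"
      using abs_Re_le_cmod[of ?\<zeta>] norm_triangle_ineq[of 1 "\<i> * of_real \<tau>"] \<tau> by (auto simp: norm_mult)
    have "cmod (\<psi> ?\<zeta>) \<le> ?B"
    proof (rule maximum_modulus_frontier[of \<psi> S])
      show "\<psi> holomorphic_on interior S"
        by (rule holomorphic_on_subset[OF hol\<psi>]) (use interior_subset[of S] in \<open>auto simp: S_def\<close>)
      show "continuous_on (closure S) \<psi>"
        using \<open>closed S\<close> by (auto intro!: continuous_on_subset[OF holomorphic_on_imp_continuous_on[OF hol\<psi>]] simp: S_def)
      show "bounded S" unfolding S_def by (intro bounded_Int) auto
      show "?\<zeta> \<in> S" using n\<zeta> \<rho> \<tau> by (auto simp: S_def)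
    qed (use bd in auto)
    moreover have "X \<le> cmod (\<psi> ?\<zeta>)"
    proof -
      have "A * (r\<^sup>2 / 15) * \<tau> \<le> A * (r\<^sup>2 / 15 * (\<tau> + \<delta>))"
        using \<open>A \<ge> 0\<close> \<delta> by (auto intro!: mult_left_mono simp: mult.assoc)
      also have "\<dots> \<le> A * Re (barrier r (1 + \<i> * of_real (\<tau> + \<delta>)))"
        using \<tau> \<delta> r \<open>A \<ge> 0\<close> by (intro mult_left_mono Re_barrier_ge) auto
      also have "1 + \<i> * of_real (\<tau> + \<delta>) = ?\<zeta> + \<i> * of_real \<delta>" by (simp add: algebra_simps)
      finally have "exp (A * (r\<^sup>2 / 15) * \<tau>) \<le> exp (A * Re (barrier r (?\<zeta> + \<i> * of_real \<delta>)))" by simp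
      moreover have "(cmod (h ?\<zeta>))\<^sup>2 \<le> cmod ?\<zeta> * (cmod (h ?\<zeta>))\<^sup>2"
        using n\<zeta>(1) mult_right_mono[OF n\<zeta>(1), of "(cmod (h ?\<zeta>))\<^sup>2"] by simp
      ultimately show ?thesis unfolding norm_psi X_def by (intro mult_mono) auto
    qed
    ultimately show ?thesis by linarith
  qed
  have "((\<lambda>\<delta>. B1 * exp (A * r) + B2 * exp (A * (2 * \<delta>)) + \<delta>) \<longlongrightarrow> B1 * exp (A * r) + B2 * exp (A * (2 * 0)) + 0) (at_right 0)"
    by (intro tendsto_intros)
  moreover have "\<forall>\<^sub>F \<delta> in at_right 0. X \<le> B1 * exp (A * r) + B2 * exp (A * (2 * \<delta>)) + \<delta>"
    unfolding eventually_at_right_field using main r(1) by (meson less_imp_le)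
  ultimately have "X \<le> B1 * exp (A * r) + B2 * exp (A * (2 * 0)) + 0"
    by (rule tendsto_lowerbound) simp
  then show ?thesis by (simp add: X_def)
qed

subsection \<open>Dilations of the Cauchy integral\<close>

text \<open>The target interval is given as an image because a negative s reverses the
  endpoints.\<close>

lemma integral_stretch_real_image:
  fixes \<phi> :: "real \<Rightarrow> real"
  assumes \<phi>: "continuous_on UNIV \<phi>" and "s \<noteq> 0" "c \<le> d"
  obtains a b where "{a..b} = (\<lambda>x. s * x) ` {c..d}"
    "\<bar>s\<bar> * integral {c..d} (\<lambda>x. \<phi> (s * x)) = integral {a..b} \<phi>"
proof -
  define a where "a = min (s * c) (s * d)"
  define b where "b = max (s * c) (s * d)"
  have ab: "{a..b} = (\<lambda>x. s * x) ` {c..d}"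
    unfolding image_mult_atLeastAtMost_if a_def b_def
    using assms by (auto simp: min_def max_def mult_le_cancel_left)
  have "(\<phi> has_integral integral {a..b} \<phi>) {a..b}"
    by (intro integrable_integral integrable_continuous_interval continuous_on_subset[OF \<phi>]) auto
  from has_integral_stretch_real[OF this \<open>s \<noteq> 0\<close>]
  have "((\<lambda>x. \<phi> (s * x)) has_integral (1 / \<bar>s\<bar>) * integral {a..b} \<phi>) ((\<lambda>x. x / s) ` {a..b})"
    by simp
  also have "(\<lambda>x. x / s) ` {a..b} = {c..d}"
    unfolding ab image_image using \<open>s \<noteq> 0\<close> by simp
  finally have "integral {c..d} (\<lambda>x. \<phi> (s * x)) = (1 / \<bar>s\<bar>) * integral {a..b} \<phi>"
    by (rule integral_unique)
  then have "\<bar>s\<bar> * integral {c..d} (\<lambda>x. \<phi> (s * x)) = integral {a..b} \<phi>"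
    using \<open>s \<noteq> 0\<close> by simp
  with ab that show thesis by blast
qed

locale gap_function =
  fixes f :: "real \<Rightarrow> complex" and R d :: real
  assumes cont: "continuous_on UNIV f" and d_pos: "0 < d" and d_le: "d \<le> R"
    and supp: "\<And>y. f y \<noteq> 0 \<Longrightarrow> d \<le> \<bar>y\<bar> \<and> \<bar>y\<bar> \<le> R"
begin

lemma R_pos: "0 < R" using d_pos d_le by simp

lemma cont': "continuous_on S f" by (rule continuous_on_subset[OF cont]) simp

text \<open>The strip keeps distance d / 2 from the support, so the Lipschitz bound holds across the
  real axis. This permits the limit \<eta> \<rightarrow> 0 on [-d/2, d/2].\<close>

lemma continuous_on_cauchy_int_gap: "continuous_on {z. \<bar>Re z\<bar> \<le> d / 2} (cauchy_int f R)"
proof -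
  let ?K = "integral {-R..R} (\<lambda>y. cmod (f y)) / (d / 2)\<^sup>2"
  have K0: "?K \<ge> 0" by (intro divide_nonneg_nonneg integral_nonneg integrable_continuous_interval continuous_intros cont') auto
  have far: "d / 2 \<le> cmod (z - of_real y)" if "f y \<noteq> 0" "\<bar>Re z\<bar> \<le> d / 2" for z y
    using supp[OF that(1)] that(2) abs_Re_le_cmod[of "z - of_real y"] by (simp, linarith)
  have "?K-lipschitz_on {z. \<bar>Re z\<bar> \<le> d / 2} (cauchy_int f R)"
  proof (rule lipschitz_onI[OF _ K0])
    fix z w :: complex assume "z \<in> {z. \<bar>Re z\<bar> \<le> d / 2}" "w \<in> {z. \<bar>Re z\<bar> \<le> d / 2}"
    then have "cmod (cauchy_int f R z - cauchy_int f R w) \<le> cmod (z - w) * ?K"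
      using d_pos by (intro cauchy_int_Lipschitz cont' far) auto
    then show "dist (cauchy_int f R z) (cauchy_int f R w) \<le> ?K * dist z w"
      by (simp add: dist_norm mult.commute)
  qed
  then show ?thesis by (rule lipschitz_on_continuous_on)
qed

text \<open>The dilation function h with the argument of F raised by i \<eta>: this makes it
  holomorphic across the real line and brings the L2 bounds on horizontal lines into play. The
  second factor is left general so that both f paired with cnj f and cnj f paired with f are
  covered.\<close>

definition shifted_dilation :: "(real \<Rightarrow> complex) \<Rightarrow> real \<Rightarrow> complex \<Rightarrow> complex" where
  "shifted_dilation g \<eta> z = integral {d..R} (\<lambda>x. cauchy_int f R (of_real x * z + \<i> * of_real \<eta>) * g x)"

lemma holomorphic_shifted_dilation:
  assumes g: "continuous_on {d..R} g" and "\<eta> > 0"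
  shows "shifted_dilation g \<eta> holomorphic_on {z. - (\<eta> / R) < Im z}"
proof -
  let ?U = "{z. - (\<eta> / R) < Im z}" and ?F = "cauchy_int f R"
  let ?p = "\<lambda>z x. of_real x * z + \<i> * of_real \<eta> :: complex"
  have hF: "?F holomorphic_on {z. 0 < Im z}" by (intro holomorphic_cauchy_int cont')
  have op: "open {z. 0 < Im z}" using open_halfspace_Im_gt[of 0] by simp
  \<comment> \<open>When Im z is negative the worst x is R, which explains the depth \<eta> / R of
    the half-plane.\<close>
  have im: "0 < Im (?p z x)" if "z \<in> ?U" "x \<in> {d..R}" for z x
  proof (cases "Im z \<ge> 0")
    case True
    then show ?thesis using that d_pos \<open>\<eta> > 0\<close> by (simp add: add_nonneg_pos)
  next
    case False
    have "R * Im z > R * (- (\<eta> / R))" using that R_pos by (intro mult_strict_left_mono) auto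
    moreover have "R * Im z \<le> x * Im z" using that False by (intro mult_right_mono_neg) auto
    ultimately show ?thesis using R_pos by simp
  qed
  have cF': "continuous_on (?U \<times> {d..R}) (\<lambda>q. deriv ?F (?p (fst q) (snd q)))"
    by (rule continuous_on_compose2[OF holomorphic_on_imp_continuous_on[OF holomorphic_deriv[OF hF op]]])
      (use im in \<open>auto intro!: continuous_intros\<close>)
  have cg: "continuous_on (?U \<times> {d..R}) (\<lambda>q. g (snd q))"
    by (rule continuous_on_compose2[OF g]) (auto intro!: continuous_intros)
  have "(\<lambda>z. integral (cbox d R) (\<lambda>x. ?F (?p z x) * g x)) holomorphic_on ?U"
  proof (rule leibniz_rule_holomorphic)
    fix z :: complex and x :: real assume z: "z \<in> ?U" and x: "x \<in> cbox d R"
    have "(?F has_field_derivative deriv ?F (?p z x)) (at (?p z x))"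
      by (rule holomorphic_derivI[OF hF op]) (use im[OF z] x in auto)
    then show "((\<lambda>z. ?F (?p z x) * g x) has_field_derivative (deriv ?F (?p z x) * of_real x) * g x) (at z within ?U)"
      by (auto intro!: derivative_eq_intros DERIV_chain2[of ?F])
  next
    fix z :: complex assume z: "z \<in> ?U"
    have "continuous_on {d..R} (\<lambda>x. ?F (?p z x))"
      by (rule continuous_on_compose2[OF holomorphic_on_imp_continuous_on[OF hF]])
        (use im[OF z] in \<open>auto intro!: continuous_intros\<close>)
    then show "(\<lambda>x. ?F (?p z x) * g x) integrable_on cbox d R"
      unfolding box_real by (intro integrable_continuous_interval continuous_intros g)
  next
    show "continuous_on (?U \<times> cbox d R) (\<lambda>(z, x). (deriv ?F (?p z x) * of_real x) * g x)"
      unfolding split_beta box_real by (intro continuous_intros cF' cg)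
  next
    show "convex ?U" using convex_halfspace_Im_gt[of "- (\<eta> / R)"] by simp
  qed
  then show ?thesis unfolding shifted_dilation_def[abs_def] box_real .
qed

text \<open>For x in [d, R] the point x z + i \<eta> has modulus at least d |z| - 1. The lower bound
  on |z| makes d |z| at least 2 (R + 1), so its distance from the disc of radius R is still at least
  d |z| / 2.\<close>

lemma shifted_dilation_decay:
  assumes g: "continuous_on {d..R} g" and \<eta>: "0 < \<eta>" "\<eta> \<le> 1"
    and z: "0 \<le> Im z" "2 * (R + 1) / d \<le> cmod z"
  shows "cmod (shifted_dilation g \<eta> z)
    \<le> 2 * integral {-R..R} (\<lambda>y. cmod (f y)) * integral {d..R} (\<lambda>x. cmod (g x)) / (d * cmod z)"
proof -
  let ?L = "integral {-R..R} (\<lambda>y. cmod (f y))"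
  let ?p = "\<lambda>x. of_real x * z + \<i> * of_real \<eta> :: complex"
  have L0: "0 \<le> ?L" by (intro integral_nonneg integrable_continuous_interval continuous_intros cont') auto
  have zd: "2 * (R + 1) \<le> d * cmod z" using z d_pos by (simp add: field_simps)
  have im: "0 < Im (?p x)" if "x \<in> {d..R}" for x
    using that d_pos \<eta> z by (simp add: add_nonneg_pos)
  have cF: "continuous_on {d..R} (\<lambda>x. cauchy_int f R (?p x))"
    by (rule continuous_on_compose2[OF holomorphic_on_imp_continuous_on[OF holomorphic_cauchy_int[OF cont']]])
      (use im in \<open>auto intro!: continuous_intros\<close>)
  have "cmod (shifted_dilation g \<eta> z) \<le> integral {d..R} (\<lambda>x. 2 * ?L / (d * cmod z) * cmod (g x))"
    unfolding shifted_dilation_def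
  proof (intro integral_norm_bound_integral integrable_continuous_interval continuous_intros cF g)
    fix x assume x: "x \<in> {d..R}"
    have "d * cmod z \<le> cmod (of_real x * z)" using x d_pos by (simp add: norm_mult mult_right_mono)
    also have "\<dots> \<le> cmod (?p x) + cmod (\<i> * of_real \<eta>)"
      using norm_triangle_ineq4[of "?p x" "\<i> * of_real \<eta>"] by simp
    finally have p: "d * cmod z / 2 \<le> cmod (?p x) - R" "R < cmod (?p x)"
      using \<eta> zd R_pos by (auto simp: norm_mult)
    have "cmod (cauchy_int f R (?p x)) \<le> ?L / (cmod (?p x) - R)"
      by (intro norm_cauchy_int_far cont' R_pos p)
    also have "\<dots> \<le> ?L / (d * cmod z / 2)"
      using L0 p zd R_pos by (intro divide_left_mono mult_pos_pos) auto
    also have "\<dots> = 2 * ?L / (d * cmod z)" by simp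
    finally show "cmod (cauchy_int f R (?p x) * g x) \<le> 2 * ?L / (d * cmod z) * cmod (g x)"
      unfolding norm_mult by (rule mult_right_mono) simp
  qed
  then show ?thesis by simp
qed

text \<open>Cauchy-Schwarz in x, then the substitution of x for s x: the weight |s| is exactly its
  Jacobian, which turns the first factor into an L2 norm of F over the dilated interval.\<close>

lemma shifted_dilation_real_le:
  assumes g: "continuous_on {d..R} g" and \<eta>: "0 < \<eta>" and "s \<noteq> 0"
  obtains a b where "{a..b} = (\<lambda>x. s * x) ` {d..R}"
    "\<bar>s\<bar> * (cmod (shifted_dilation g \<eta> (of_real s)))\<^sup>2
    \<le> integral {d..R} (\<lambda>x. (cmod (g x))\<^sup>2)
      * integral {a..b} (\<lambda>x. (cmod (cauchy_int f R (of_real x + \<i> * of_real \<eta>)))\<^sup>2)"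
proof -
  let ?\<phi> = "\<lambda>x. (cmod (cauchy_int f R (of_real x + \<i> * of_real \<eta>)))\<^sup>2"
  have c: "continuous_on S (\<lambda>x. cauchy_int f R (of_real x + \<i> * of_real \<eta>))" for S
    using \<eta> by (intro continuous_on_cauchy_int_horizontal cont') auto
  obtain a b where ab: "{a..b} = (\<lambda>x. s * x) ` {d..R}"
    "\<bar>s\<bar> * integral {d..R} (\<lambda>x. ?\<phi> (s * x)) = integral {a..b} ?\<phi>"
    by (rule integral_stretch_real_image[of ?\<phi> s d R]) (auto intro!: continuous_intros c \<open>s \<noteq> 0\<close> d_le)
  have "(cmod (shifted_dilation g \<eta> (of_real s)))\<^sup>2 \<le> integral {d..R} (\<lambda>x. ?\<phi> (s * x)) * integral {d..R} (\<lambda>x. (cmod (g x))\<^sup>2)"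
  proof -
    have "continuous_on {d..R} (\<lambda>x. cauchy_int f R (of_real (x * s) + \<i> * of_real \<eta>))"
      by (rule continuous_on_compose2[OF c[of UNIV]]) (auto intro!: continuous_intros)
    from norm_integral_Cauchy_Schwarz[OF this g] show ?thesis
      unfolding shifted_dilation_def by (simp add: mult.commute)
  qed
  then have "\<bar>s\<bar> * (cmod (shifted_dilation g \<eta> (of_real s)))\<^sup>2
      \<le> \<bar>s\<bar> * (integral {d..R} (\<lambda>x. ?\<phi> (s * x)) * integral {d..R} (\<lambda>x. (cmod (g x))\<^sup>2))"
    by (rule mult_left_mono) simp
  also have "\<dots> = integral {d..R} (\<lambda>x. (cmod (g x))\<^sup>2) * integral {a..b} ?\<phi>"
    by (simp add: ab(2)[symmetric])
  finally show thesis using that ab(1) by blast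
qed

text \<open>The choice r = d / (4 R) means that |s| \<le> 2 r maps [d, R] into [-d/2, d/2], where
  only the local mass E enters; for larger |s| the global bound 4 N of \<open>cauchy_int_L2\<close>
  is used. The estimate is proved at height \<eta> and then \<eta> tends to 0.\<close>

lemma dilation_two_constants:
  assumes g: "continuous_on {d..R} g" and \<tau>: "0 < \<tau>" "\<tau> \<le> 1" and "A \<ge> 0"
  defines "r \<equiv> d / (4 * R)"
  defines "N \<equiv> integral {-R..R} (\<lambda>x. (cmod (f x))\<^sup>2)"
    and "G \<equiv> integral {d..R} (\<lambda>x. (cmod (g x))\<^sup>2)"
    and "E \<equiv> integral {-(d/2)..d/2} (\<lambda>x. (cmod (cauchy_int f R (of_real x)))\<^sup>2)"
  shows "(cmod (integral {d..R} (\<lambda>x. cauchy_int f R (of_real x + \<i> * of_real (x * \<tau>)) * g x)))\<^sup>2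
      * exp (A * (r\<^sup>2 / 15) * \<tau>) \<le> G * E * exp (A * r) + 4 * N * G"
proof -
  let ?F = "cauchy_int f R" and ?\<zeta> = "1 + \<i> * of_real \<tau>"
  define E' where "E' = (\<lambda>\<eta>. integral {-(d/2)..d/2} (\<lambda>x. (cmod (?F (of_real x + \<i> * of_real \<eta>)))\<^sup>2))"
  define L where "L = integral {-R..R} (\<lambda>y. cmod (f y))"
  define G1 where "G1 = integral {d..R} (\<lambda>x. cmod (g x))"
  have r: "0 < r" "r \<le> 1" unfolding r_def using d_pos d_le by (auto simp: divide_simps)
  have nonneg: "0 \<le> N" "0 \<le> G" "0 \<le> L" "0 \<le> G1" unfolding N_def G_def L_def G1_def
    by (intro integral_nonneg integrable_continuous_interval continuous_intros cont' g; simp)+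
  have cF: "continuous_on S (\<lambda>x. ?F (of_real x + \<i> * of_real \<eta>))" if "\<eta> > 0" for S \<eta>
    using that by (intro continuous_on_cauchy_int_horizontal cont') auto
  have step: "(cmod (shifted_dilation g \<eta> ?\<zeta>))\<^sup>2 * exp (A * (r\<^sup>2 / 15) * \<tau>)
      \<le> G * E' \<eta> * exp (A * r) + 4 * N * G" if \<eta>: "0 < \<eta>" "\<eta> \<le> 1" for \<eta>
  proof (rule two_constants_half_plane[OF holomorphic_shifted_dilation[OF g \<eta>(1)]])
    show "0 < \<eta> / R" using \<eta> R_pos by simp
    show "cmod z * (cmod (shifted_dilation g \<eta> z))\<^sup>2 \<le> (2 * L * G1 / d)\<^sup>2 / cmod z"
      if z: "0 \<le> Im z" "2 * (R + 1) / d \<le> cmod z" for z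
    proof -
      have "0 < cmod z" using z(2) d_pos R_pos by (intro less_le_trans[OF _ z(2)]) auto
      have "(cmod (shifted_dilation g \<eta> z))\<^sup>2 \<le> (2 * L * G1 / (d * cmod z))\<^sup>2"
        using shifted_dilation_decay[OF g \<eta> z] by (intro power_mono) (auto simp: L_def G1_def)
      then have "cmod z * (cmod (shifted_dilation g \<eta> z))\<^sup>2 \<le> cmod z * (2 * L * G1 / (d * cmod z))\<^sup>2"
        by (rule mult_left_mono) simp
      also have "\<dots> = (2 * L * G1 / d)\<^sup>2 / cmod z" using \<open>0 < cmod z\<close> by (simp add: power2_eq_square)
      finally show ?thesis .
    qed
    have E'0: "0 \<le> E' \<eta>" unfolding E'_def
      by (intro integral_nonneg integrable_continuous_interval continuous_intros cF \<eta>) auto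
    then show "0 \<le> G * E' \<eta>" "0 \<le> 4 * N * G" using nonneg by auto
    show "\<bar>s\<bar> * (cmod (shifted_dilation g \<eta> (of_real s)))\<^sup>2 \<le> G * E' \<eta>" if s: "\<bar>s\<bar> \<le> 2 * r" for s
    proof (cases "s = 0")
      case True
      then show ?thesis using nonneg E'0 by simp
    next
      case False
      then obtain a b where ab: "{a..b} = (\<lambda>x. s * x) ` {d..R}"
        "\<bar>s\<bar> * (cmod (shifted_dilation g \<eta> (of_real s)))\<^sup>2
          \<le> G * integral {a..b} (\<lambda>x. (cmod (?F (of_real x + \<i> * of_real \<eta>)))\<^sup>2)"
        using shifted_dilation_real_le[OF g \<eta>(1)] unfolding G_def by metis
      have "\<bar>s * x\<bar> \<le> d / 2" if "x \<in> {d..R}" for x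
      proof -
        have "\<bar>s * x\<bar> \<le> 2 * r * R" unfolding abs_mult using s that d_pos r by (intro mult_mono) auto
        then show ?thesis using R_pos by (simp add: r_def)
      qed
      then have sub: "{a..b} \<subseteq> {-(d/2)..d/2}" unfolding ab(1) by (force simp: abs_le_iff)
      note ab(2)
      also have "G * integral {a..b} (\<lambda>x. (cmod (?F (of_real x + \<i> * of_real \<eta>)))\<^sup>2) \<le> G * E' \<eta>"
        unfolding E'_def using nonneg
        by (intro mult_left_mono integral_subset_le sub integrable_continuous_interval continuous_intros cF \<eta>) auto
      finally show ?thesis .
    qed
    show "\<bar>s\<bar> * (cmod (shifted_dilation g \<eta> (of_real s)))\<^sup>2 \<le> 4 * N * G" if s: "2 * r \<le> \<bar>s\<bar>" for s
    proof -
      have "s \<noteq> 0" using s r by auto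
      then obtain a b where 
        "\<bar>s\<bar> * (cmod (shifted_dilation g \<eta> (of_real s)))\<^sup>2
          \<le> G * integral {a..b} (\<lambda>x. (cmod (?F (of_real x + \<i> * of_real \<eta>)))\<^sup>2)"
        using shifted_dilation_real_le[OF g \<eta>(1)] unfolding G_def by metis
      also have "\<dots> \<le> G * (4 * N)"
        unfolding N_def using nonneg by (intro mult_left_mono cauchy_int_L2 cont' R_pos \<eta>)
      finally show ?thesis by (simp add: ac_simps)
    qed
  qed (use r \<tau> \<open>A \<ge> 0\<close> in auto)
  \<comment> \<open>At 1 + i \<tau> the dilated points have imaginary part at least d \<tau>, so
    \<eta> = 0 is harmless here.\<close>
  have c1: "continuous_on {0..1} (\<lambda>\<eta>. shifted_dilation g \<eta> ?\<zeta>)"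
  proof -
    have "continuous_on ({0..1} \<times> {d..R}) (\<lambda>q. ?F (of_real (snd q) * ?\<zeta> + \<i> * of_real (fst q)))"
      by (rule continuous_on_compose2[OF holomorphic_on_imp_continuous_on[OF holomorphic_cauchy_int[OF cont']]])
        (use \<tau> d_pos in \<open>auto intro!: continuous_intros add_pos_nonneg\<close>)
    moreover have "continuous_on ({0..1::real} \<times> {d..R}) (\<lambda>q. g (snd q))"
      by (rule continuous_on_compose2[OF g]) (auto intro!: continuous_intros)
    ultimately have "continuous_on ({0..1} \<times> cbox d R) (\<lambda>(\<eta>, x). ?F (of_real x * ?\<zeta> + \<i> * of_real \<eta>) * g x)"
      unfolding split_beta box_real by (intro continuous_intros)
    from integral_continuous_on_param[OF this] show ?thesis
      by (simp add: shifted_dilation_def)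
  qed
  \<comment> \<open>Here \<eta> = 0 puts the points on the real line, but inside the gap.\<close>
  have c2: "continuous_on {0..1} E'"
  proof -
    have "continuous_on ({0..1} \<times> {-(d/2)..d/2}) (\<lambda>q. ?F (of_real (snd q) + \<i> * of_real (fst q)))"
      by (rule continuous_on_compose2[OF continuous_on_cauchy_int_gap]) (auto intro!: continuous_intros)
    then have "continuous_on ({0..1} \<times> cbox (-(d/2)) (d/2)) (\<lambda>(\<eta>, x). (cmod (?F (of_real x + \<i> * of_real \<eta>)))\<^sup>2)"
      unfolding split_beta box_real by (intro continuous_intros)
    from integral_continuous_on_param[OF this] show ?thesis
      by (simp add: E'_def)
  qed
  have lim: "(cmod (shifted_dilation g 0 ?\<zeta>))\<^sup>2 * exp (A * (r\<^sup>2 / 15) * \<tau>) \<le> G * E' 0 * exp (A * r) + 4 * N * G"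
  proof (rule tendsto_le)
    show "((\<lambda>\<eta>. G * E' \<eta> * exp (A * r) + 4 * N * G) \<longlongrightarrow> G * E' 0 * exp (A * r) + 4 * N * G) (at_right 0)"
      by (intro tendsto_intros continuous_on_Icc_at_rightD[OF c2]) simp
    show "((\<lambda>\<eta>. (cmod (shifted_dilation g \<eta> ?\<zeta>))\<^sup>2 * exp (A * (r\<^sup>2 / 15) * \<tau>))
        \<longlongrightarrow> (cmod (shifted_dilation g 0 ?\<zeta>))\<^sup>2 * exp (A * (r\<^sup>2 / 15) * \<tau>)) (at_right 0)"
      by (intro tendsto_intros continuous_on_Icc_at_rightD[OF c1]) simp
    show "\<forall>\<^sub>F \<eta> in at_right 0. (cmod (shifted_dilation g \<eta> ?\<zeta>))\<^sup>2 * exp (A * (r\<^sup>2 / 15) * \<tau>)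
      \<le> G * E' \<eta> * exp (A * r) + 4 * N * G"
      unfolding eventually_at_right_field using step by (intro exI[of _ 1]) auto
  qed simp
  have "E' 0 = E" by (simp add: E'_def E_def)
  moreover have "shifted_dilation g 0 ?\<zeta> = integral {d..R} (\<lambda>x. ?F (of_real x + \<i> * of_real (x * \<tau>)) * g x)"
    unfolding shifted_dilation_def by (simp add: algebra_simps)
  ultimately show ?thesis using lim by simp
qed

lemma gap_function_cnj: "gap_function (\<lambda>x. cnj (f x)) R d"
  by unfold_locales (use d_pos d_le supp in \<open>auto intro!: continuous_intros cont\<close>)

lemma continuous_on_cauchy_int_dilated:
  assumes "\<tau> > 0"
  shows "continuous_on {d..R} (\<lambda>x. cauchy_int f R (of_real x + \<i> * of_real (x * \<tau>)))"
  by (rule continuous_on_compose2[OF holomorphic_on_imp_continuous_on[OF holomorphic_cauchy_int[OF cont']]])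
    (use assms d_pos in \<open>auto intro!: continuous_intros\<close>)

end

subsection \<open>Mollification by differences of Poisson kernels\<close>

text \<open>The combination \<open>2 P\<^sub>t - P\<^bsub>2t\<^esub>\<close> decays like \<open>t\<^sup>3 / u\<^sup>4\<close>, so that, unlike the Poisson kernel itself,
  it has a first moment, which is of order \<open>t\<close>.\<close>
definition mollifier :: "real \<Rightarrow> real \<Rightarrow> real" where
  "mollifier t u = 2 * poisson_kernel t u - poisson_kernel (2 * t) u"

lemma mollifier_eq:
  assumes "t > 0"
  shows "mollifier t u = 6 * t^3 / (pi * ((u\<^sup>2 + t\<^sup>2) * (u\<^sup>2 + (2 * t)\<^sup>2)))"
proof -
  have nz: "u\<^sup>2 + t\<^sup>2 \<noteq> 0" "u\<^sup>2 + (2 * t)\<^sup>2 \<noteq> 0" using assms sum_power2_neq_zero[of t u] sum_power2_neq_zero[of "2 * t" u] by auto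
  have "mollifier t u = (2 * t * (u\<^sup>2 + (2 * t)\<^sup>2) - 2 * t * (u\<^sup>2 + t\<^sup>2)) / (pi * ((u\<^sup>2 + t\<^sup>2) * (u\<^sup>2 + (2 * t)\<^sup>2)))"
    unfolding mollifier_def poisson_kernel_def using nz by (simp add: diff_frac_eq divide_simps)
  then show ?thesis by (simp add: power2_eq_square power3_eq_cube algebra_simps)
qed

lemma mollifier_nonneg: "t > 0 \<Longrightarrow> 0 \<le> mollifier t u"
  by (simp add: mollifier_eq)

lemma continuous_on_mollifier [continuous_intros]:
  assumes "continuous_on S g" "continuous_on S h" "\<And>x. x \<in> S \<Longrightarrow> g x \<noteq> 0"
  shows "continuous_on S (\<lambda>x. mollifier (g x) (h x))"
  unfolding mollifier_def by (intro continuous_intros assms) (use assms in auto)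

text \<open>The arithmetic-geometric mean inequality cancels one factor of the denominator, leaving
  a function of t that increases, hence is largest at T. The bound is thus uniform in t \<le> T, as
  needed for a scale that varies with x, and it is integrable in u with total of order T.\<close>

lemma mollifier_moment_le:
  assumes "0 < t" "t \<le> T"
  shows "mollifier t u * \<bar>u\<bar> \<le> 3 / 2 * T * poisson_kernel (2 * T) u"
proof -
  have pos: "u\<^sup>2 + t\<^sup>2 > 0" "u\<^sup>2 + (2 * t)\<^sup>2 > 0" "u\<^sup>2 + (2 * T)\<^sup>2 > 0"
    using assms by (auto intro!: add_nonneg_pos)
  have "0 \<le> (\<bar>u\<bar> - t)\<^sup>2" by simp
  then have amgm: "2 * t * \<bar>u\<bar> \<le> u\<^sup>2 + t\<^sup>2" by (simp add: power2_diff algebra_simps)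
  have "mollifier t u * \<bar>u\<bar> = 3 * t\<^sup>2 / pi * (2 * t * \<bar>u\<bar>) / ((u\<^sup>2 + t\<^sup>2) * (u\<^sup>2 + (2 * t)\<^sup>2))"
    using assms by (simp add: mollifier_eq power2_eq_square power3_eq_cube)
  also have "\<dots> \<le> 3 * t\<^sup>2 / pi * (u\<^sup>2 + t\<^sup>2) / ((u\<^sup>2 + t\<^sup>2) * (u\<^sup>2 + (2 * t)\<^sup>2))"
    using pos amgm assms by (intro divide_right_mono mult_left_mono) auto
  also have "\<dots> = 3 / pi * (t\<^sup>2 / (u\<^sup>2 + (2 * t)\<^sup>2))" using pos by simp
  also have "\<dots> \<le> 3 / pi * (T\<^sup>2 / (u\<^sup>2 + (2 * T)\<^sup>2))"
  proof (rule mult_left_mono)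
    have "t\<^sup>2 \<le> T\<^sup>2" using assms by (intro power_mono) auto
    then have "t\<^sup>2 * u\<^sup>2 \<le> T\<^sup>2 * u\<^sup>2" by (intro mult_right_mono) auto
    then show "t\<^sup>2 / (u\<^sup>2 + (2 * t)\<^sup>2) \<le> T\<^sup>2 / (u\<^sup>2 + (2 * T)\<^sup>2)"
      using pos by (simp add: divide_simps algebra_simps power_mult_distrib)
  qed simp
  also have "3 / pi * (T\<^sup>2 / (u\<^sup>2 + (2 * T)\<^sup>2)) = 3 / 2 * T * poisson_kernel (2 * T) u"
    by (simp add: poisson_kernel_def power2_eq_square)
  finally show ?thesis .
qed

text \<open>By the reflection formula for arctan the missing mass is the difference of two arctan
  terms, both between 0 and 4 t / (pi U).\<close>

lemma abs_one_minus_integral_mollifier_le: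
  assumes "0 < t" "0 < U"
  shows "\<bar>1 - integral {-U..U} (mollifier t)\<bar> \<le> 4 / pi * (t / U)"
proof -
  have P: "(poisson_kernel s has_integral 2 * arctan (U / s) / pi) {-U..U}" if "s > 0" for s
    using has_integral_poisson_kernel[OF that, of "-U" U 0] assms by (simp add: arctan_minus)
  have inv: "arctan (U / s) = pi / 2 - arctan (s / U)" if "s > 0" for s
    using arctan_inverse[of "s / U"] that assms by (simp add: inverse_eq_divide)
  have "(mollifier t has_integral 2 * (2 * arctan (U / t) / pi) - 2 * arctan (U / (2 * t)) / pi) {-U..U}"
    unfolding mollifier_def[abs_def] using assms by (intro has_integral_diff has_integral_mult_right P) auto
  then have "integral {-U..U} (mollifier t) = 2 * (2 * arctan (U / t) / pi) - 2 * arctan (U / (2 * t)) / pi"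
    by (rule integral_unique)
  also have "\<dots> = 2 * (2 * (pi / 2 - arctan (t / U)) / pi) - 2 * (pi / 2 - arctan (2 * t / U)) / pi"
    using assms inv[of t] inv[of "2 * t"] by simp
  finally have I: "integral {-U..U} (mollifier t)
    = 2 * (2 * (pi / 2 - arctan (t / U)) / pi) - 2 * (pi / 2 - arctan (2 * t / U)) / pi" .
  have "1 - integral {-U..U} (mollifier t) = 4 / pi * arctan (t / U) - 2 / pi * arctan (2 * t / U)"
    unfolding I by (simp add: field_simps)
  moreover have "0 \<le> arctan (t / U)" "arctan (t / U) \<le> t / U" "0 \<le> arctan (2 * t / U)" "arctan (2 * t / U) \<le> 2 * t / U"
    using assms by (auto intro!: arctan_le_self)
  then have "0 \<le> 4 / pi * arctan (t / U)" "4 / pi * arctan (t / U) \<le> 4 / pi * (t / U)"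
     "0 \<le> 2 / pi * arctan (2 * t / U)" "2 / pi * arctan (2 * t / U) \<le> 2 / pi * (2 * t / U)"
    by (intro mult_nonneg_nonneg mult_left_mono; simp)+
  ultimately show ?thesis by simp
qed

lemma integral_translate_le:
  fixes \<phi> :: "real \<Rightarrow> real"
  assumes \<phi>: "continuous_on UNIV \<phi>" "\<And>x. 0 \<le> \<phi> x" "\<And>x. R < \<bar>x\<bar> \<Longrightarrow> \<phi> x = 0"
  shows "integral {a..b} (\<lambda>x. \<phi> (x - v)) \<le> integral {-R..R} \<phi>"
proof -
  have c: "continuous_on S \<phi>" for S by (rule continuous_on_subset[OF \<phi>(1)]) simp
  define T where "T = \<bar>R\<bar> + \<bar>a\<bar> + \<bar>b\<bar> + \<bar>v\<bar>"
  have "integral {a..b} (\<lambda>x. \<phi> (x - v)) = integral {a - v..b - v} \<phi>"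
    using integral_shift[of "a" "- v" "b" \<phi>] c by (simp add: o_def)
  also have "\<dots> \<le> integral {-T..T} \<phi>"
    by (intro integral_subset_le integrable_continuous_interval c) (use \<phi> in \<open>auto simp: T_def\<close>)
  also have "\<dots> = integral {-R..R} \<phi>"
    by (rule integral_zero_extend(2)[OF c]) (use \<phi>(3) in \<open>auto simp: T_def\<close>)
  finally show ?thesis .
qed

text \<open>For |x| \<le> R and u in [-2 R, 2 R] the point x - u sweeps over all of [-R, R]; the
  domain of integration in u no longer depends on x.\<close>

lemma poisson_int_translate:
  fixes f :: "real \<Rightarrow> complex"
  assumes f: "continuous_on UNIV f" "\<And>y. R < \<bar>y\<bar> \<Longrightarrow> f y = 0" and "t > 0" "\<bar>x\<bar> \<le> R"
  shows "poisson_int f R t x = integral {-2 * R..2 * R} (\<lambda>u. of_real (poisson_kernel t u) * f (x - u))"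
proof -
  define \<phi> where "\<phi> = (\<lambda>y. of_real (poisson_kernel t (x - y)) * f y)"
  have c: "continuous_on S \<phi>" for S
    unfolding \<phi>_def using \<open>t > 0\<close> by (intro continuous_intros continuous_on_subset[OF f(1)]) auto
  have "integral {-2 * R..2 * R} (\<lambda>u. of_real (poisson_kernel t u) * f (x - u))
      = integral {-2 * R..2 * R} (\<lambda>u. \<phi> (x - u))" by (simp add: \<phi>_def)
  also have "\<dots> = integral {-2 * R..2 * R} (\<lambda>u. \<phi> (x + u))"
    using Henstock_Kurzweil_Integration.integral_reflect_real[of "2 * R" "-2 * R" "\<lambda>u. \<phi> (x + u)"] by simp
  also have "\<dots> = integral {-2 * R + x..2 * R + x} \<phi>"
    using integral_shift[of "-2 * R" x "2 * R" \<phi>] c by (simp add: o_def add.commute)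
  also have "\<dots> = integral {-R..R} \<phi>"
    by (rule integral_zero_extend(2)[OF c]) (use assms in \<open>auto simp: \<phi>_def\<close>)
  finally show ?thesis by (simp add: poisson_int_def \<phi>_def)
qed

section \<open>The L2 error of mollification for C1 functions\<close>

locale C1_gap_function = gap_function +
  fixes f' :: "real \<Rightarrow> complex"
  assumes deriv: "\<And>x. (f has_vector_derivative f' x) (at x)"
    and cont_deriv: "continuous_on UNIV f'"
    and supp_deriv: "\<And>x. R < \<bar>x\<bar> \<Longrightarrow> f' x = 0"
begin

definition "N = integral {-R..R} (\<lambda>x. (cmod (f x))\<^sup>2)"
definition "N' = integral {-R..R} (\<lambda>x. (cmod (f' x))\<^sup>2)"

text \<open>Fundamental theorem of calculus along the segment from x to x - u, kept as an average
  over s so that f' can be measured in L2 and not in the supremum norm.\<close>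

lemma norm_diff_le: "cmod (f x - f (x - u)) \<le> \<bar>u\<bar> * integral {0..1} (\<lambda>s. cmod (f' (x - s * u)))"
proof -
  have c: "continuous_on {0..1} (\<lambda>s. f' (x - s * u))"
    by (rule continuous_on_compose2[OF cont_deriv]) (auto intro!: continuous_intros)
  have "((\<lambda>s. (- u) *\<^sub>R f' (x - s * u)) has_integral f (x - 1 * u) - f (x - 0 * u)) {0..1}"
  proof (intro fundamental_theorem_of_calculus)
    fix s :: real
    have "((\<lambda>s. x - s * u) has_vector_derivative - u) (at s within {0..1})"
      by (auto intro!: derivative_eq_intros)
    from vector_diff_chain_within[OF this has_vector_derivative_at_within[OF deriv]]
    show "((\<lambda>s. f (x - s * u)) has_vector_derivative (- u) *\<^sub>R f' (x - s * u)) (at s within {0..1})"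
      by (simp add: o_def)
  qed simp
  from integral_unique[OF this] have "f (x - u) - f x = integral {0..1} (\<lambda>s. (- u) *\<^sub>R f' (x - s * u))"
    unfolding mult_1 mult_zero_left diff_zero by (rule sym)
  also have "\<dots> = (- u) *\<^sub>R integral {0..1} (\<lambda>s. f' (x - s * u))" by (rule integral_cmul)
  finally have "cmod (f (x - u) - f x) = \<bar>u\<bar> * cmod (integral {0..1} (\<lambda>s. f' (x - s * u)))"
    by simp
  then have "cmod (f x - f (x - u)) = \<bar>u\<bar> * cmod (integral {0..1} (\<lambda>s. f' (x - s * u)))"
    by (simp only: norm_minus_commute)
  then show ?thesis using norm_integral_le_integral_norm[OF c] by (simp add: mult_left_mono)
qed

text \<open>For each fixed s, Cauchy-Schwarz and translation invariance give the bound; it is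
  independent of s and of the displacement u.\<close>

lemma integral_norm_f_deriv_le:
  "integral {d..R} (\<lambda>x. cmod (f x) * integral {0..1} (\<lambda>s. cmod (f' (x - s * u)))) \<le> sqrt N * sqrt N'"
proof -
  have cf': "continuous_on ({d..R} \<times> {0..1}) (\<lambda>p. f' (fst p - snd p * u))"
    by (rule continuous_on_compose2[OF cont_deriv]) (auto intro!: continuous_intros)
  have cf: "continuous_on ({d..R} \<times> {0..1::real}) (\<lambda>p. f (fst p))"
    by (rule continuous_on_compose2[OF cont]) (auto intro!: continuous_intros)
  have c: "continuous_on ({d..R} \<times> {0..1}) (\<lambda>(x, s). cmod (f x) * cmod (f' (x - s * u)))"
    unfolding split_beta by (intro continuous_intros cf cf')
  have "integral {d..R} (\<lambda>x. cmod (f x) * integral {0..1} (\<lambda>s. cmod (f' (x - s * u))))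
      = integral {d..R} (\<lambda>x. integral {0..1} (\<lambda>s. cmod (f x) * cmod (f' (x - s * u))))" by simp
  also have "\<dots> = integral {0..1} (\<lambda>s. integral {d..R} (\<lambda>x. cmod (f x) * cmod (f' (x - s * u))))"
    by (rule integral_swap_rectangle[OF c])
  also have "\<dots> \<le> integral {0..1::real} (\<lambda>s. sqrt N * sqrt N')"
  proof (rule integral_le)
    have "continuous_on ({0..1} \<times> {d..R}) (\<lambda>(s, x). cmod (f x) * cmod (f' (x - s * u)))"
      unfolding split_beta
      by (intro continuous_intros continuous_on_compose2[OF cont] continuous_on_compose2[OF cont_deriv]) auto
    then show "(\<lambda>s. integral {d..R} (\<lambda>x. cmod (f x) * cmod (f' (x - s * u)))) integrable_on {0..1}"
      using integral_continuous_on_param[of "{0..1}" d R "\<lambda>s x. cmod (f x) * cmod (f' (x - s * u))"]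
      by (auto intro!: integrable_continuous_interval)
    show "integral {d..R} (\<lambda>x. cmod (f x) * cmod (f' (x - s * u))) \<le> sqrt N * sqrt N'" for s
    proof -
      have cs: "continuous_on {d..R} (\<lambda>x. f' (x - s * u))"
        by (rule continuous_on_compose2[OF cont_deriv]) (auto intro!: continuous_intros)
      have "(integral {d..R} (\<lambda>x. cmod (f x) * cmod (f' (x - s * u))))\<^sup>2
          \<le> integral {d..R} (\<lambda>x. (cmod (f x))\<^sup>2) * integral {d..R} (\<lambda>x. (cmod (f' (x - s * u)))\<^sup>2)"
        by (intro integral_Cauchy_Schwarz continuous_intros cont' cs)
      also have "\<dots> \<le> N * N'"
      proof (intro mult_mono)
        show "integral {d..R} (\<lambda>x. (cmod (f x))\<^sup>2) \<le> N"
          unfolding N_def using d_pos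
          by (intro integral_subset_le integrable_continuous_interval continuous_intros cont') auto
        show "integral {d..R} (\<lambda>x. (cmod (f' (x - s * u)))\<^sup>2) \<le> N'"
          unfolding N'_def
          by (rule integral_translate_le) (use supp_deriv in \<open>auto intro!: continuous_intros cont_deriv\<close>)
        show "0 \<le> N" unfolding N_def by (intro integral_nonneg integrable_continuous_interval continuous_intros cont') auto
        show "0 \<le> integral {d..R} (\<lambda>x. (cmod (f' (x - s * u)))\<^sup>2)"
          by (intro integral_nonneg integrable_continuous_interval continuous_intros cs) auto
      qed
      finally show ?thesis by (metis real_le_rsqrt real_sqrt_mult)
    qed
  qed auto
  finally show ?thesis by simp
qed

lemma continuous_on_poisson_int_dilated:
  assumes "\<tau> > 0"
  shows "continuous_on {d..R} (\<lambda>x. poisson_int f R (x * \<tau>) x)"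
proof -
  have "continuous_on ({d..R} \<times> cbox (-R) R) (\<lambda>(x, y). of_real (poisson_kernel (x * \<tau>) (x - y)) * f y)"
    unfolding split_beta using d_pos assms
    by (intro continuous_intros continuous_on_compose2[OF cont]) auto
  from integral_continuous_on_param[OF this] show ?thesis by (simp add: poisson_int_def)
qed

text \<open>The difference splits into the kernel tested on f x - f (x - u) and the mass missing
  from [-2 R, 2 R], which is at most \<tau>. The scale x \<tau> is the height to which dilation by 1
  + i \<tau> lifts x; the bound is expressed at the scale R \<tau>, so its weight in u does not
  depend on x.\<close>

lemma norm_diff_mollified_le:
  assumes \<tau>: "0 < \<tau>" and x: "x \<in> {d..R}"
  shows "cmod (f x - (2 * poisson_int f R (x * \<tau>) x - poisson_int f R (x * (2 * \<tau>)) x))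
    \<le> integral {-2 * R..2 * R} (\<lambda>u. 3 / 2 * (R * \<tau>) * poisson_kernel (2 * (R * \<tau>)) u
        * integral {0..1} (\<lambda>s. cmod (f' (x - s * u)))) + \<tau> * cmod (f x)"
proof -
  define t where "t = x * \<tau>"
  let ?I = "{-2 * R..2 * R}"
  have t: "0 < t" "t \<le> R * \<tau>" unfolding t_def using x d_pos \<tau> by auto
  have xR: "\<bar>x\<bar> \<le> R" using x d_pos by auto
  have f0: "f y = 0" if "R < \<bar>y\<bar>" for y using supp[of y] that by fastforce
  have cfx: "continuous_on S (\<lambda>u. f (x - u))" for S
    by (rule continuous_on_compose2[OF cont]) (auto intro!: continuous_intros)
  have ck: "continuous_on S (mollifier t)" for S
    by (rule continuous_on_mollifier[of S "\<lambda>_. t" "\<lambda>u. u"]) (use t in auto)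
  have "2 * poisson_int f R t x - poisson_int f R (2 * t) x
      = integral ?I (\<lambda>u. of_real (mollifier t u) * f (x - u))"
  proof -
    have i: "(\<lambda>u. of_real (poisson_kernel s u) * f (x - u)) integrable_on ?I" if "s > 0" for s
      using that by (intro integrable_continuous_interval continuous_intros cfx) auto
    have "2 * poisson_int f R t x - poisson_int f R (2 * t) x
      = integral ?I (\<lambda>u. 2 * (of_real (poisson_kernel t u) * f (x - u)) - of_real (poisson_kernel (2 * t) u) * f (x - u))"
      using t xR i[of t] i[of "2 * t"] f0 by (subst integral_diff) (auto simp: poisson_int_translate[OF cont])
    then show ?thesis by (simp add: mollifier_def algebra_simps)
  qed
  moreover have "integral ?I (\<lambda>u. of_real (mollifier t u) * (f x - f (x - u)))
      = of_real (integral ?I (mollifier t)) * f x - integral ?I (\<lambda>u. of_real (mollifier t u) * f (x - u))"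
  proof -
    have "((\<lambda>u. of_real (mollifier t u) * f x - of_real (mollifier t u) * f (x - u)) has_integral
       of_real (integral ?I (mollifier t)) * f x - integral ?I (\<lambda>u. of_real (mollifier t u) * f (x - u))) ?I"
      by (intro has_integral_diff has_integral_mult_left has_integral_of_real integrable_integral
          integrable_continuous_interval continuous_intros cfx ck)
    then show ?thesis by (simp add: integral_unique right_diff_distrib)
  qed
  ultimately have eq: "f x - (2 * poisson_int f R t x - poisson_int f R (2 * t) x)
      = integral ?I (\<lambda>u. of_real (mollifier t u) * (f x - f (x - u))) + of_real (1 - integral ?I (mollifier t)) * f x"
    by (simp add: algebra_simps)
  have "cmod (integral ?I (\<lambda>u. of_real (mollifier t u) * (f x - f (x - u))))
      \<le> integral ?I (\<lambda>u. 3 / 2 * (R * \<tau>) * poisson_kernel (2 * (R * \<tau>)) u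
        * integral {0..1} (\<lambda>s. cmod (f' (x - s * u))))"
  proof (intro integral_norm_bound_integral integrable_continuous_interval continuous_intros cfx ck)
    have "continuous_on (?I \<times> cbox 0 1) (\<lambda>(u, s). cmod (f' (x - s * u)))"
      unfolding split_beta by (intro continuous_intros continuous_on_compose2[OF cont_deriv]) auto
    from integral_continuous_on_param[OF this]
    show "continuous_on ?I (\<lambda>u. integral {0..1} (\<lambda>s. cmod (f' (x - s * u))))" by simp
    show "2 * (R * \<tau>) \<noteq> 0" "t \<noteq> 0" using R_pos \<tau> t by simp_all
    fix u
    have "cmod (of_real (mollifier t u) * (f x - f (x - u))) = mollifier t u * cmod (f x - f (x - u))"
      using t by (simp add: norm_mult mollifier_nonneg)
    also have "\<dots> \<le> mollifier t u * (\<bar>u\<bar> * integral {0..1} (\<lambda>s. cmod (f' (x - s * u))))"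
      using t by (intro mult_left_mono norm_diff_le mollifier_nonneg)
    also have "\<dots> = mollifier t u * \<bar>u\<bar> * integral {0..1} (\<lambda>s. cmod (f' (x - s * u)))" by simp
    also have "\<dots> \<le> 3 / 2 * (R * \<tau>) * poisson_kernel (2 * (R * \<tau>)) u * integral {0..1} (\<lambda>s. cmod (f' (x - s * u)))"
      by (intro mult_right_mono mollifier_moment_le t integral_nonneg integrable_continuous_interval
          continuous_intros continuous_on_compose2[OF cont_deriv]) auto
    finally show "cmod (of_real (mollifier t u) * (f x - f (x - u)))
      \<le> 3 / 2 * (R * \<tau>) * poisson_kernel (2 * (R * \<tau>)) u * integral {0..1} (\<lambda>s. cmod (f' (x - s * u)))" .
  qed
  moreover have "\<bar>1 - integral ?I (mollifier t)\<bar> \<le> \<tau>"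
  proof -
    have "\<bar>1 - integral ?I (mollifier t)\<bar> \<le> 4 / pi * (t / (2 * R))"
      using abs_one_minus_integral_mollifier_le[of t "2 * R"] t R_pos by simp
    also have "\<dots> \<le> 4 / pi * (R * \<tau> / (2 * R))" using t R_pos by (intro mult_left_mono divide_right_mono) auto
    also have "\<dots> = 2 / pi * \<tau>" using R_pos by simp
    also have "\<dots> \<le> 1 * \<tau>" using pi_gt3 \<tau> by (intro mult_right_mono) auto
    finally show ?thesis by simp
  qed
  then have "cmod (of_real (1 - integral ?I (mollifier t)) * f x) \<le> \<tau> * cmod (f x)"
    unfolding norm_mult norm_of_real by (intro mult_right_mono) auto
  moreover have "x * (2 * \<tau>) = 2 * t" by (simp add: t_def)
  ultimately show ?thesis
    unfolding t_def[symmetric] \<open>x * (2 * \<tau>) = 2 * t\<close> eq by (intro norm_triangle_mono)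
qed

text \<open>Pair the splitting of f into its mollification and the error with cnj f. The
  mollification yields the two Poisson pairings, the moment of the kernel the product of N and N'
  terms, and the missing mass the last N.\<close>

lemma mollified_L2_error:
  assumes \<tau>: "0 < \<tau>"
  shows "integral {d..R} (\<lambda>x. (cmod (f x))\<^sup>2)
    \<le> 2 * cmod (integral {d..R} (\<lambda>x. poisson_int f R (x * \<tau>) x * cnj (f x)))
      + cmod (integral {d..R} (\<lambda>x. poisson_int f R (x * (2 * \<tau>)) x * cnj (f x)))
      + \<tau> * (3 / 2 * R * sqrt N * sqrt N' + N)"
proof -
  let ?P = "\<lambda>\<tau> x. poisson_int f R (x * \<tau>) x"
  let ?m = "\<lambda>u x. integral {0..1} (\<lambda>s. cmod (f' (x - s * u)))"
  let ?b = "\<lambda>u. 3 / 2 * (R * \<tau>) * poisson_kernel (2 * (R * \<tau>)) u"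
  let ?I = "{-2 * R..2 * R}"
  have RT: "2 * (R * \<tau>) > 0" using R_pos \<tau> by simp
  have cP: "continuous_on {d..R} (?P \<tau>)" "continuous_on {d..R} (?P (2 * \<tau>))"
    using \<tau> by (auto intro!: continuous_on_poisson_int_dilated simp del: mult.left_commute)
  have cm: "continuous_on ({d..R} \<times> ?I) (\<lambda>(x, u). ?m u x)"
  proof -
    have "continuous_on (({d..R} \<times> ?I) \<times> cbox 0 1) (\<lambda>(p, s). cmod (f' (fst p - s * snd p)))"
      unfolding split_beta by (intro continuous_intros continuous_on_compose2[OF cont_deriv]) auto
    from integral_continuous_on_param[OF this] show ?thesis by (simp add: split_beta)
  qed
  have cbm: "continuous_on ({d..R} \<times> ?I) (\<lambda>(x, u). cmod (f x) * (?b u * ?m u x))"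
    using cm RT unfolding split_beta by (intro continuous_intros continuous_on_compose2[OF cont]) auto
  have cbm': "continuous_on ({d..R} \<times> ?I) (\<lambda>(x, u). ?b u * ?m u x)"
    using cm RT unfolding split_beta by (intro continuous_intros) auto
  have cB: "continuous_on {d..R} (\<lambda>x. integral ?I (\<lambda>u. ?b u * ?m u x))"
    using integral_continuous_on_param[of "{d..R}" "-2 * R" "2 * R" "\<lambda>x u. ?b u * ?m u x"] cbm' by simp
  have N0: "0 \<le> N" unfolding N_def by (intro integral_nonneg integrable_continuous_interval continuous_intros cont') auto
  have N'0: "0 \<le> N'" unfolding N'_def
    by (intro integral_nonneg integrable_continuous_interval continuous_intros continuous_on_subset[OF cont_deriv]) auto
  have GN: "integral {d..R} (\<lambda>x. (cmod (f x))\<^sup>2) \<le> N"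
    unfolding N_def using d_pos
    by (intro integral_subset_le integrable_continuous_interval continuous_intros cont') auto
  have "of_real (integral {d..R} (\<lambda>x. (cmod (f x))\<^sup>2)) = integral {d..R} (\<lambda>x. f x * cnj (f x))"
    by (rule integral_unique[symmetric])
      (auto simp: complex_norm_square[symmetric] simp del: of_real_power
        intro!: has_integral_of_real integrable_integral integrable_continuous_interval continuous_intros cont')
  also have "\<dots> = 2 * integral {d..R} (\<lambda>x. ?P \<tau> x * cnj (f x)) - integral {d..R} (\<lambda>x. ?P (2 * \<tau>) x * cnj (f x))
      + integral {d..R} (\<lambda>x. (f x - (2 * ?P \<tau> x - ?P (2 * \<tau>) x)) * cnj (f x))" (is "_ = ?A + ?E")
  proof -
    have "((\<lambda>x. 2 * (?P \<tau> x * cnj (f x)) - ?P (2 * \<tau>) x * cnj (f x) + (f x - (2 * ?P \<tau> x - ?P (2 * \<tau>) x)) * cnj (f x))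
      has_integral ?A + ?E) {d..R}"
      by (intro has_integral_add has_integral_diff has_integral_mult_right integrable_integral
        integrable_continuous_interval continuous_intros cP cont')
    then show ?thesis by (simp add: integral_unique algebra_simps)
  qed
  finally have eq: "of_real (integral {d..R} (\<lambda>x. (cmod (f x))\<^sup>2)) = ?A + ?E" .
  have "cmod ?E \<le> integral {d..R} (\<lambda>x. cmod (f x) * integral ?I (\<lambda>u. ?b u * ?m u x) + \<tau> * (cmod (f x))\<^sup>2)"
  proof (intro integral_norm_bound_integral integrable_continuous_interval continuous_intros cP cont' cB)
    fix x assume x: "x \<in> {d..R}"
    have "cmod ((f x - (2 * ?P \<tau> x - ?P (2 * \<tau>) x)) * cnj (f x))
       \<le> (integral ?I (\<lambda>u. ?b u * ?m u x) + \<tau> * cmod (f x)) * cmod (f x)"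
      unfolding norm_mult complex_mod_cnj by (intro mult_right_mono norm_diff_mollified_le \<tau> x) auto
    then show "cmod ((f x - (2 * ?P \<tau> x - ?P (2 * \<tau>) x)) * cnj (f x))
       \<le> cmod (f x) * integral ?I (\<lambda>u. ?b u * ?m u x) + \<tau> * (cmod (f x))\<^sup>2"
      by (simp add: power2_eq_square algebra_simps)
  qed
  also have "\<dots> = integral {d..R} (\<lambda>x. cmod (f x) * integral ?I (\<lambda>u. ?b u * ?m u x)) + \<tau> * integral {d..R} (\<lambda>x. (cmod (f x))\<^sup>2)"
    by (intro integral_unique has_integral_add has_integral_mult_right integrable_integral
        integrable_continuous_interval continuous_intros cont' cB)
  also have "integral {d..R} (\<lambda>x. cmod (f x) * integral ?I (\<lambda>u. ?b u * ?m u x))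
     = integral {d..R} (\<lambda>x. integral ?I (\<lambda>u. cmod (f x) * (?b u * ?m u x)))" by simp
  \<comment> \<open>With u outermost, \<open>integral_norm_f_deriv_le\<close> applies for each u,
    and the remaining integral of the Poisson kernel is at most 1.\<close>
  also have "\<dots> = integral ?I (\<lambda>u. integral {d..R} (\<lambda>x. cmod (f x) * (?b u * ?m u x)))"
    by (rule integral_swap_rectangle[OF cbm])
  also have "\<dots> \<le> integral ?I (\<lambda>u. ?b u * (sqrt N * sqrt N'))"
  proof (rule integral_le)
    have sw: "continuous_on (?I \<times> {d..R}) (\<lambda>p. (snd p, fst p))" by (intro continuous_intros)
    have "continuous_on (?I \<times> {d..R}) (\<lambda>p. (\<lambda>(x, u). cmod (f x) * (?b u * ?m u x)) (snd p, fst p))"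
      by (rule continuous_on_compose2[OF cbm sw]) auto
    then have "continuous_on (?I \<times> cbox d R) (\<lambda>(u, x). cmod (f x) * (?b u * ?m u x))"
      by (simp add: split_beta)
    from integral_continuous_on_param[OF this]
    show "(\<lambda>u. integral {d..R} (\<lambda>x. cmod (f x) * (?b u * ?m u x))) integrable_on ?I"
      unfolding box_real by (rule integrable_continuous_interval)
    show "(\<lambda>u. ?b u * (sqrt N * sqrt N')) integrable_on ?I"
      using RT by (intro integrable_continuous_interval continuous_intros) auto
    fix u
    have "integral {d..R} (\<lambda>x. cmod (f x) * (?b u * ?m u x)) = integral {d..R} (\<lambda>x. ?b u * (cmod (f x) * ?m u x))"
      by (simp add: mult.left_commute)
    also have "\<dots> = ?b u * integral {d..R} (\<lambda>x. cmod (f x) * ?m u x)" by (rule integral_mult_right)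
    also have "\<dots> \<le> ?b u * (sqrt N * sqrt N')"
      using RT R_pos \<tau> by (intro mult_left_mono integral_norm_f_deriv_le mult_nonneg_nonneg poisson_kernel_nonneg) auto
    finally show "integral {d..R} (\<lambda>x. cmod (f x) * (?b u * ?m u x)) \<le> ?b u * (sqrt N * sqrt N')" .
  qed
  also have "integral ?I (\<lambda>u. ?b u * (sqrt N * sqrt N')) = 3 / 2 * (R * \<tau>) * integral ?I (poisson_kernel (2 * (R * \<tau>))) * (sqrt N * sqrt N')"
    by simp
  also have "\<dots> \<le> 3 / 2 * (R * \<tau>) * 1 * (sqrt N * sqrt N')"
    using integral_poisson_kernel_le_1[OF RT, of "-2 * R" "2 * R" 0] N0 N'0 R_pos \<tau>
    by (intro mult_right_mono mult_left_mono) auto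
  finally have "cmod ?E \<le> 3 / 2 * (R * \<tau>) * (sqrt N * sqrt N') + \<tau> * integral {d..R} (\<lambda>x. (cmod (f x))\<^sup>2)"
    by simp
  also have "\<dots> \<le> 3 / 2 * (R * \<tau>) * (sqrt N * sqrt N') + \<tau> * N"
    using GN \<tau> by simp
  finally have E: "cmod ?E \<le> \<tau> * (3 / 2 * R * sqrt N * sqrt N' + N)" by (simp add: algebra_simps)
  have "integral {d..R} (\<lambda>x. (cmod (f x))\<^sup>2) \<le> cmod (of_real (integral {d..R} (\<lambda>x. (cmod (f x))\<^sup>2)))"
    unfolding norm_of_real by simp
  also have "\<dots> \<le> cmod ?A + cmod ?E" unfolding eq by (rule norm_triangle_ineq)
  also have "cmod ?A \<le> 2 * cmod (integral {d..R} (\<lambda>x. ?P \<tau> x * cnj (f x))) + cmod (integral {d..R} (\<lambda>x. ?P (2 * \<tau>) x * cnj (f x)))"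
    by (rule order_trans[OF norm_triangle_ineq4]) (simp add: norm_mult)
  finally show ?thesis using E by linarith
qed

section \<open>The dilation estimate and mollification combined\<close>

definition "E = integral {-(d/2)..d/2} (\<lambda>x. (cmod (cauchy_int f R (of_real x)))\<^sup>2)"

lemma N_nonneg: "0 \<le> N" and N'_nonneg: "0 \<le> N'" and E_nonneg: "0 \<le> E"
proof -
  show "0 \<le> N" "0 \<le> N'" unfolding N_def N'_def
    by (intro integral_nonneg integrable_continuous_interval continuous_intros cont'
        continuous_on_subset[OF cont_deriv]; simp)+
  have "continuous_on {-(d/2)..d/2} (\<lambda>x. cauchy_int f R (of_real x))"
    by (rule continuous_on_compose2[OF continuous_on_cauchy_int_gap]) (auto intro!: continuous_intros)
  then show "0 \<le> E" unfolding E_def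
    by (intro integral_nonneg integrable_continuous_interval continuous_intros) auto
qed

text \<open>The jump relation expresses the Poisson integral by F above and below the real line. The
  value below is the conjugate of the Cauchy integral of cnj f above, so both halves follow from
  \<open>dilation_two_constants\<close>, once for f and once for cnj f, with the same N and
  E.\<close>

lemma poisson_pairing_le:
  assumes \<tau>: "0 < \<tau>" "\<tau> \<le> 1" and A: "0 \<le> A"
  defines "r \<equiv> d / (4 * R)"
  shows "(cmod (integral {d..R} (\<lambda>x. poisson_int f R (x * \<tau>) x * cnj (f x))))\<^sup>2 * exp (A * (r\<^sup>2 / 15) * \<tau>)
    \<le> N * E * exp (A * r) + 4 * N\<^sup>2"
proof -
  interpret c: gap_function "\<lambda>x. cnj (f x)" R d by (rule gap_function_cnj)
  define V where "V = integral {d..R} (\<lambda>x. cauchy_int f R (of_real x + \<i> * of_real (x * \<tau>)) * cnj (f x))"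
  define V' where "V' = integral {d..R} (\<lambda>x. cauchy_int (\<lambda>x. cnj (f x)) R (of_real x + \<i> * of_real (x * \<tau>)) * f x)"
  define W where "W = integral {d..R} (\<lambda>x. poisson_int f R (x * \<tau>) x * cnj (f x))"
  define G where "G = integral {d..R} (\<lambda>x. (cmod (f x))\<^sup>2)"
  let ?e = "exp (A * (r\<^sup>2 / 15) * \<tau>)"
  have GN: "G \<le> N" unfolding G_def N_def using d_pos
    by (intro integral_subset_le integrable_continuous_interval continuous_intros cont') auto
  have Q: "G * E * exp (A * r) + 4 * N * G \<le> N * E * exp (A * r) + 4 * N\<^sup>2"
    using GN N_nonneg E_nonneg by (auto intro!: add_mono mult_right_mono mult_left_mono simp: power2_eq_square)
  have V: "(cmod V)\<^sup>2 * ?e \<le> N * E * exp (A * r) + 4 * N\<^sup>2"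
    using dilation_two_constants[of "\<lambda>x. cnj (f x)", OF _ \<tau> A] Q
    by (simp add: V_def G_def E_def N_def r_def continuous_on_cnj cont')
  have "cauchy_int (\<lambda>x. cnj (f x)) R (of_real x) = cnj (cauchy_int f R (of_real x))" for x
    by (simp add: cauchy_int_cnj)
  then have V': "(cmod V')\<^sup>2 * ?e \<le> N * E * exp (A * r) + 4 * N\<^sup>2"
    using c.dilation_two_constants[of f, OF _ \<tau> A] Q
    by (simp add: V'_def G_def E_def N_def r_def cont')
  have jump: "poisson_int f R (x * \<tau>) x = \<i> / 2 * (cauchy_int f R (of_real x + \<i> * of_real (x * \<tau>))
      - cnj (cauchy_int (\<lambda>x. cnj (f x)) R (of_real x + \<i> * of_real (x * \<tau>))))" if "x \<in> {d..R}" for x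
  proof -
    have "x * \<tau> \<noteq> 0" using that d_pos \<tau> by simp
    note jump = cauchy_int_jump[OF cont' this, of R x]
    have "\<i> / 2 * (cauchy_int f R (of_real x + \<i> * of_real (x * \<tau>))
      - cnj (cauchy_int (\<lambda>x. cnj (f x)) R (of_real x + \<i> * of_real (x * \<tau>))))
      = \<i> / 2 * (- 2 * \<i> * poisson_int f R (x * \<tau>) x)"
      unfolding jump[symmetric] by (simp add: cauchy_int_cnj)
    then show ?thesis by simp
  qed
  have "((\<lambda>x. \<i> / 2 * (cauchy_int f R (of_real x + \<i> * of_real (x * \<tau>)) * cnj (f x)
      - cnj (cauchy_int (\<lambda>x. cnj (f x)) R (of_real x + \<i> * of_real (x * \<tau>)) * f x))) has_integral \<i> / 2 * (V - cnj V')) {d..R}"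
    unfolding V_def V'_def Henstock_Kurzweil_Integration.integral_cnj
    by (intro has_integral_mult_right has_integral_diff integrable_integral integrable_continuous_interval
      continuous_intros continuous_on_cauchy_int_dilated c.continuous_on_cauchy_int_dilated \<tau> cont')
  then have "\<i> / 2 * (V - cnj V') = integral {d..R} (\<lambda>x. \<i> / 2 * (cauchy_int f R (of_real x + \<i> * of_real (x * \<tau>)) * cnj (f x)
      - cnj (cauchy_int (\<lambda>x. cnj (f x)) R (of_real x + \<i> * of_real (x * \<tau>)) * f x)))"
    by (rule integral_unique[symmetric])
  also have "\<dots> = W" unfolding W_def
    by (rule integral_cong) (simp add: jump algebra_simps)
  finally have "cmod W = cmod (V - cnj V') / 2" by (metis norm_mult norm_divide norm_ii norm_numeral mult_1 times_divide_eq_left)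
  also have "\<dots> \<le> (cmod V + cmod V') / 2" using norm_triangle_ineq4[of V "cnj V'"] by simp
  finally have "(cmod W)\<^sup>2 \<le> ((cmod V + cmod V') / 2)\<^sup>2" by (rule power_mono) simp
  also have "\<dots> \<le> ((cmod V)\<^sup>2 + (cmod V')\<^sup>2) / 2"
    using zero_le_power2[of "cmod V - cmod V'"] by (simp add: power2_eq_square field_simps)
  finally have "(cmod W)\<^sup>2 * ?e \<le> ((cmod V)\<^sup>2 + (cmod V')\<^sup>2) / 2 * ?e" by (rule mult_right_mono) simp
  also have "\<dots> = ((cmod V)\<^sup>2 * ?e + (cmod V')\<^sup>2 * ?e) / 2" by (simp add: field_simps)
  also have "\<dots> \<le> N * E * exp (A * r) + 4 * N\<^sup>2" using V V' by simp
  finally show ?thesis by (simp add: W_def)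
qed

text \<open>The factor 3 counts two pairings at \<tau> and one at 2 \<tau>; since the exponential
  gain increases with the height, the one for \<tau> serves for both. The bound \<tau> \<le> 1/2
  keeps 2 \<tau> admissible.\<close>

lemma half_line_L2_le:
  assumes \<tau>: "0 < \<tau>" "\<tau> \<le> 1 / 2" and A: "0 \<le> A"
  defines "r \<equiv> d / (4 * R)"
  shows "integral {d..R} (\<lambda>x. (cmod (f x))\<^sup>2)
    \<le> 3 * sqrt ((N * E * exp (A * r) + 4 * N\<^sup>2) / exp (A * (r\<^sup>2 / 15) * \<tau>))
      + \<tau> * (3 / 2 * R * sqrt N * sqrt N' + N)"
proof -
  let ?Q = "N * E * exp (A * r) + 4 * N\<^sup>2"
  let ?W = "\<lambda>\<tau>. cmod (integral {d..R} (\<lambda>x. poisson_int f R (x * \<tau>) x * cnj (f x)))"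
  have Q: "0 \<le> ?Q" using N_nonneg E_nonneg by simp
  have "?W \<sigma> \<le> sqrt (?Q / exp (A * (r\<^sup>2 / 15) * \<tau>))" if \<sigma>: "\<tau> \<le> \<sigma>" "\<sigma> \<le> 1" for \<sigma>
  proof (rule real_le_rsqrt)
    have "(?W \<sigma>)\<^sup>2 * exp (A * (r\<^sup>2 / 15) * \<tau>) \<le> (?W \<sigma>)\<^sup>2 * exp (A * (r\<^sup>2 / 15) * \<sigma>)"
      using \<sigma> A by (intro mult_left_mono) (auto intro!: mult_left_mono)
    also have "\<dots> \<le> ?Q" unfolding r_def using \<sigma> \<tau> by (intro poisson_pairing_le A) auto
    finally show "(?W \<sigma>)\<^sup>2 \<le> ?Q / exp (A * (r\<^sup>2 / 15) * \<tau>)" by (simp add: pos_le_divide_eq)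
  qed
  from this[of \<tau>] this[of "2 * \<tau>"] mollified_L2_error[OF \<tau>(1)] \<tau> show ?thesis by linarith
qed

lemma C1_gap_function_reflect: "C1_gap_function (\<lambda>x. f (- x)) R d (\<lambda>x. - f' (- x))"
proof unfold_locales
  show "continuous_on UNIV (\<lambda>x. f (- x))" "continuous_on UNIV (\<lambda>x. - f' (- x))"
    by (auto intro!: continuous_intros continuous_on_compose2[OF cont] continuous_on_compose2[OF cont_deriv])
  show "((\<lambda>x. f (- x)) has_vector_derivative - f' (- x)) (at x)" for x
  proof -
    have "(uminus has_vector_derivative - 1) (at x)" by (auto intro!: derivative_eq_intros)
    from vector_diff_chain_at[OF this deriv] show ?thesis by (simp add: o_def)
  qed
  show "d \<le> \<bar>y\<bar> \<and> \<bar>y\<bar> \<le> R" if "f (- y) \<noteq> 0" for y using supp[OF that] by simp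
qed (use d_pos d_le supp_deriv in auto)

text \<open>The dilation argument only sees [d, R]. The reflected function has the same N, N' and E
  and covers [-R, -d], while f vanishes in between; adding the two estimates doubles the
  constants.\<close>

lemma L2_le:
  assumes \<tau>: "0 < \<tau>" "\<tau> \<le> 1 / 2" and A: "0 \<le> A"
  defines "r \<equiv> d / (4 * R)"
  shows "N \<le> 6 * sqrt ((N * E * exp (A * r) + 4 * N\<^sup>2) / exp (A * (r\<^sup>2 / 15) * \<tau>))
      + 2 * \<tau> * (3 / 2 * R * sqrt N * sqrt N' + N)"
proof -
  interpret m: C1_gap_function "\<lambda>x. f (- x)" R d "\<lambda>x. - f' (- x)" by (rule C1_gap_function_reflect)
  let ?\<phi> = "\<lambda>x. (cmod (f x))\<^sup>2"
  note refl = Henstock_Kurzweil_Integration.integral_reflect_real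
  have mN: "m.N = N" unfolding m.N_def N_def using refl[of R "-R" ?\<phi>] by simp
  have mN': "m.N' = N'" unfolding m.N'_def N'_def using refl[of R "-R" "\<lambda>x. (cmod (f' x))\<^sup>2"] by simp
  have mE: "m.E = E" unfolding m.E_def E_def
    using refl[of "d/2" "-(d/2)" "\<lambda>x. (cmod (cauchy_int f R (of_real x)))\<^sup>2"]
    by (simp add: cauchy_int_reflect)
  have int: "?\<phi> integrable_on {a..b}" for a b
    by (intro integrable_continuous_interval continuous_intros cont')
  have "N = integral {-R..-d} ?\<phi> + integral {-d..R} ?\<phi>"
    unfolding N_def using d_pos d_le
    by (intro Henstock_Kurzweil_Integration.integral_combine[symmetric] int) auto
  also have "integral {-d..R} ?\<phi> = integral {-d..d} ?\<phi> + integral {d..R} ?\<phi>"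
    using d_pos d_le by (intro Henstock_Kurzweil_Integration.integral_combine[symmetric] int) auto
  also have "integral {-d..d} ?\<phi> = 0"
  proof -
    have "integral {-d..d} ?\<phi> = integral {-d..d} (\<lambda>x. 0)"
    proof (rule integral_spike[of "{-d, d}"])
      show "0 = ?\<phi> x" if "x \<in> {-d..d} - {-d, d}" for x using supp[of x] that by (cases "f x = 0") auto
    qed auto
    then show ?thesis by simp
  qed
  also have "integral {-R..-d} ?\<phi> = integral {d..R} (\<lambda>x. ?\<phi> (- x))"
    using refl[of R d "\<lambda>x. ?\<phi> (- x)"] by simp
  finally have "N = integral {d..R} ?\<phi> + integral {d..R} (\<lambda>x. ?\<phi> (- x))" by simp
  then show ?thesis
    using half_line_L2_le[OF \<tau> A] m.half_line_L2_le[OF \<tau> A] unfolding mN mN' mE r_def by linarith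
qed

text \<open>The dilation parameter is chosen proportional to \<open>sqrt N / M\<close>, so that the mollification error is
  absorbed in the left-hand side; \<open>A\<close> is then chosen so that the term \<open>4 N\<^sup>2\<close> is absorbed as well.\<close>
lemma L2_le_exp:
  assumes N: "0 < N" and M: "0 \<le> M" "M\<^sup>2 = N + N'"
  defines "r \<equiv> d / (4 * R)"
  shows "sqrt N \<le> exp (30 * ln 1152 * (3 / 2 * R + 1) / r * (M / sqrt N)) * sqrt E"
proof -
  define c where "c = r\<^sup>2 / 15"
  \<comment> \<open>With this b the mollification error is at most N / 2, and b \<ge> 4 together
    with sqrt N \<le> M gives \<tau> \<le> 1/4.\<close>
  define b where "b = 4 * (3 / 2 * R + 1)"
  define \<tau> where "\<tau> = sqrt N / (M * b)"
  \<comment> \<open>This makes the gain equal to 1152: after squaring, 36 * 4 / 1152 = 1/8 is half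
    of the 1/4 that multiplies N^2 on the left.\<close>
  define A where "A = ln 1152 / (c * \<tau>)"
  have r: "0 < r" unfolding r_def using d_pos R_pos by simp
  have b: "4 \<le> b" unfolding b_def using R_pos by simp
  have sM: "sqrt N \<le> M" "sqrt N' \<le> M"
    using M N_nonneg N'_nonneg by (auto intro!: real_le_lsqrt)
  have sN0: "0 < sqrt N" using N by simp
  with sM(1) have "0 < M" by linarith
  note sN = sN0 this
  have c: "0 < c" using r by (simp add: c_def)
  have \<tau>0: "0 < \<tau>" unfolding \<tau>_def using sN b by simp
  have "sqrt N / (M * b) \<le> M / (M * b)" using sM sN b by (intro divide_right_mono) auto
  also have "\<dots> \<le> 1 / 4" using sN b by (simp add: field_simps)
  finally have "\<tau> \<le> 1 / 4" unfolding \<tau>_def .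
  then have \<tau>1: "\<tau> \<le> 1 / 2" by simp
  have A0: "0 \<le> A" unfolding A_def using c \<tau>0 by simp
  have "2 * \<tau> * (3 / 2 * R * sqrt N * sqrt N' + N) \<le> 2 * \<tau> * (3 / 2 * R * sqrt N * M + sqrt N * M)"
  proof -
    have "N = sqrt N * sqrt N" using N by simp
    also have "\<dots> \<le> sqrt N * M" using sM sN by (intro mult_left_mono) auto
    finally show ?thesis using sM sN \<tau>0 R_pos by (intro mult_left_mono add_mono) auto
  qed
  also have "\<dots> = 2 * \<tau> * (sqrt N * M * (b / 4))" by (simp add: b_def algebra_simps)
  also have "\<dots> = N / 2" unfolding \<tau>_def using sN b N by (simp add: field_simps)
  finally have err: "2 * \<tau> * (3 / 2 * R * sqrt N * sqrt N' + N) \<le> N / 2" .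
  have "exp (A * (r\<^sup>2 / 15) * \<tau>) = 1152"
    unfolding A_def c_def[symmetric] using c \<tau>0 by simp
  with L2_le[OF \<tau>0 \<tau>1 A0] err have "N / 2 \<le> 6 * sqrt ((N * E * exp (A * r) + 4 * N\<^sup>2) / 1152)"
    unfolding r_def by simp
  then have "(N / 2)\<^sup>2 \<le> (6 * sqrt ((N * E * exp (A * r) + 4 * N\<^sup>2) / 1152))\<^sup>2"
    using N by (intro power_mono) auto
  also have "\<dots> = 36 * ((N * E * exp (A * r) + 4 * N\<^sup>2) / 1152)"
    using N E_nonneg by (simp add: power_mult_distrib)
  finally have "N * N \<le> N * (E * exp (A * r))" using N by (simp add: power2_eq_square field_simps)
  then have "N \<le> E * exp (A * r)" using N by simp
  then have "sqrt N \<le> sqrt (E * (exp (A * r / 2))\<^sup>2)"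
    by (simp add: exp_double[symmetric] power2_eq_square exp_add[symmetric])
  also have "\<dots> = exp (A * r / 2) * sqrt E" by (simp add: real_sqrt_mult)
  also have "A * r / 2 = 30 * ln 1152 * (3 / 2 * R + 1) / r * (M / sqrt N)"
    unfolding A_def \<tau>_def c_def b_def using r sN by (simp add: field_simps power2_eq_square)
  finally show ?thesis .
qed

end

subsection \<open>The Hilbert transform away from the support\<close>

lemma lborel_integral_translate_compact_support:
  fixes \<phi> :: "real \<Rightarrow> 'a::euclidean_space"
  assumes \<phi>: "continuous_on {-R..R} (\<lambda>u. \<phi> (a + u))" and supp: "\<And>x. R < \<bar>x - a\<bar> \<Longrightarrow> \<phi> x = 0"
  shows "integral\<^sup>L lborel \<phi> = integral {-R..R} (\<lambda>u. \<phi> (a + u))"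
proof -
  have "integral\<^sup>L lborel \<phi> = (LINT u|lborel. \<phi> (a + u))"
    using lborel_integral_real_affine[of 1 \<phi> a] by simp
  also have "\<dots> = (LINT u:{-R..R}|lborel. \<phi> (a + u))"
    unfolding set_lebesgue_integral_def
    by (rule Bochner_Integration.integral_cong) (use supp in \<open>auto simp: indicator_def\<close>)
  also have "\<dots> = integral {-R..R} (\<lambda>u. \<phi> (a + u))"
    by (intro set_borel_integral_eq_integral borel_integrable_atLeastAtMost' \<phi>)
  finally show ?thesis .
qed

lemma L2_norm_translate:
  assumes f: "continuous_on UNIV f" and I: "\<And>x. x \<notin> I \<Longrightarrow> f x = 0" and supp: "\<And>x. R < \<bar>x - a\<bar> \<Longrightarrow> f x = 0"
  shows "L2_norm I f = sqrt (integral {-R..R} (\<lambda>u. (cmod (f (a + u)))\<^sup>2))"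
proof -
  have c: "continuous_on {-R..R} (\<lambda>u. f (a + u))"
    by (rule continuous_on_compose2[OF f]) (auto intro!: continuous_intros)
  have "(LINT x:I|lborel. (cmod (f x))\<^sup>2) = (LINT x|lborel. (cmod (f x))\<^sup>2)"
    unfolding set_lebesgue_integral_def
    by (rule Bochner_Integration.integral_cong) (use I in \<open>auto simp: indicator_def\<close>)
  also have "\<dots> = integral {-R..R} (\<lambda>u. (cmod (f (a + u)))\<^sup>2)"
    by (rule lborel_integral_translate_compact_support) (use supp in \<open>auto intro!: continuous_intros c\<close>)
  finally show ?thesis by (simp add: L2_norm_def)
qed

text \<open>For \<epsilon> < \<delta> the truncation removes only points where f vanishes, so the
  truncated integrals are constant near \<epsilon> = 0 and the limit is trivial.\<close>

lemma Hilbert_transform_off_support: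
  assumes "0 < \<delta>" and far: "\<And>y. f y \<noteq> 0 \<Longrightarrow> \<delta> \<le> \<bar>x - y\<bar>"
  shows "Hilbert_transform f x = of_real (1 / pi) * (LINT y|lborel. f y / of_real (x - y))"
proof -
  have "\<forall>\<^sub>F \<epsilon> in at_right 0. (LINT y:{y. \<bar>x - y\<bar> > \<epsilon>}|lborel. f y / complex_of_real (x - y))
      = (LINT y|lborel. f y / of_real (x - y))"
    unfolding eventually_at_right_field
  proof (intro exI[of _ \<delta>] conjI allI impI \<open>0 < \<delta>\<close>)
    fix \<epsilon> assume "0 < \<epsilon>" "\<epsilon> < \<delta>"
    then have "f y = 0" if "\<not> \<epsilon> < \<bar>x - y\<bar>" for y using far[of y] that by fastforce
    then show "(LINT y:{y. \<bar>x - y\<bar> > \<epsilon>}|lborel. f y / complex_of_real (x - y))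
      = (LINT y|lborel. f y / of_real (x - y))"
      unfolding set_lebesgue_integral_def
      by (intro Bochner_Integration.integral_cong) (auto simp: indicator_def)
  qed
  then have "Lim (at_right 0) (\<lambda>\<epsilon>. LINT y:{y. \<bar>x - y\<bar> > \<epsilon>}|lborel. f y / complex_of_real (x - y))
      = (LINT y|lborel. f y / of_real (x - y))"
    by (intro tendsto_Lim tendsto_eventually) simp_all
  then show ?thesis by (simp add: Hilbert_transform_def)
qed

lemma Hilbert_transform_eq_cauchy_int:
  assumes f: "continuous_on UNIV f" and supp: "\<And>y. R < \<bar>y - a\<bar> \<Longrightarrow> f y = 0"
    and "0 < \<delta>" and far: "\<And>y. f y \<noteq> 0 \<Longrightarrow> \<delta> \<le> \<bar>x - y\<bar>"
  shows "Hilbert_transform f x = cauchy_int (\<lambda>u. f (a + u)) R (of_real (x - a))"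
proof -
  have c: "continuous_on {-R..R} (\<lambda>u. f (a + u))"
    by (rule continuous_on_compose2[OF f]) (auto intro!: continuous_intros)
  have "\<delta> \<le> cmod (of_real (x - a) - of_real u)" if "f (a + u) \<noteq> 0" for u
  proof -
    have "cmod (of_real (x - a) - of_real u) = \<bar>x - (a + u)\<bar>"
      unfolding of_real_diff[symmetric] norm_of_real by (simp add: diff_diff_eq)
    then show ?thesis using far[OF that] by simp
  qed
  then have "continuous_on {-R..R} (\<lambda>u. f (a + u) / (of_real (x - a) - of_real u))"
    by (intro continuous_on_cauchy_integrand[OF c \<open>0 < \<delta>\<close>]) auto
  then have c': "continuous_on {-R..R} (\<lambda>u. f (a + u) / of_real (x - (a + u)))"
    by (simp add: diff_diff_eq)
  have "(LINT y|lborel. f y / of_real (x - y)) = integral {-R..R} (\<lambda>u. f (a + u) / of_real (x - (a + u)))"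
    by (rule lborel_integral_translate_compact_support[OF c']) (use supp in auto)
  then show ?thesis
    using Hilbert_transform_off_support[OF \<open>0 < \<delta>\<close> far] by (simp add: cauchy_int_def diff_diff_eq)
qed

text \<open>On J the Hilbert transform is the Cauchy integral at real points, recentred at a. The
  left-hand side is therefore its L2 norm over an interval contained in J, which is how the local
  mass E enters the final estimate.\<close>

lemma Hilbert_transform_L2_ge:
  assumes f: "continuous_on UNIV f" and supp: "\<And>y. R < \<bar>y - a\<bar> \<Longrightarrow> f y = 0"
    and \<delta>: "0 < \<delta>" and far: "\<And>x y. x \<in> J \<Longrightarrow> f y \<noteq> 0 \<Longrightarrow> \<delta> \<le> \<bar>x - y\<bar>"
    and J: "open J" "bounded J" and sub: "{a - j..a + j} \<subseteq> J"
  shows "sqrt (integral {-j..j} (\<lambda>v. (cmod (cauchy_int (\<lambda>u. f (a + u)) R (of_real v)))\<^sup>2))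
    \<le> L2_norm J (Hilbert_transform f)"
proof -
  \<comment> \<open>This integral agrees with the Hilbert transform on J and is Borel measurable on
    the whole line.\<close>
  define h where "h = (\<lambda>x. of_real (1 / pi) * (LINT y|lborel. f y / complex_of_real (x - y)))"
  define L where "L = integral {-R..R} (\<lambda>u. cmod (f (a + u)))"
  let ?F = "cauchy_int (\<lambda>u. f (a + u)) R"
  have c: "continuous_on {-R..R} (\<lambda>u. f (a + u))"
    by (rule continuous_on_compose2[OF f]) (auto intro!: continuous_intros)
  have Hh: "Hilbert_transform f x = h x" if "x \<in> J" for x
    unfolding h_def using far[OF that] by (intro Hilbert_transform_off_support[OF \<delta>])
  have HF: "Hilbert_transform f x = ?F (of_real (x - a))" if "x \<in> J" for x
    using far[OF that] supp by (intro Hilbert_transform_eq_cauchy_int[OF f _ \<delta>]) auto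
  have dist: "\<delta> \<le> cmod (of_real (x - a) - of_real u)" if "x \<in> J" "f (a + u) \<noteq> 0" for x u
  proof -
    have "cmod (of_real (x - a) - of_real u) = \<bar>x - (a + u)\<bar>"
      unfolding of_real_diff[symmetric] norm_of_real by (simp add: diff_diff_eq)
    then show ?thesis using far[OF that] by simp
  qed
  have bd: "(cmod (h x))\<^sup>2 \<le> (L / \<delta>)\<^sup>2" if "x \<in> J" for x
    using norm_cauchy_int_le[OF c \<delta>, of "of_real (x - a)"] dist[OF that] Hh[OF that] HF[OF that]
    by (intro power_mono) (auto simp: L_def)
  have [measurable]: "f \<in> borel_measurable borel" by (rule borel_measurable_continuous_onI[OF f])
  have [measurable]: "h \<in> borel_measurable borel" unfolding h_def by measurable
  \<comment> \<open>Integrability over J is essential: otherwise the Bochner integral over J would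
    be 0 by convention and could not dominate that over the smaller interval. It follows from
    boundedness of h on J and of J itself.\<close>
  have int: "integrable lborel (\<lambda>x. indicator J x *\<^sub>R (cmod (h x))\<^sup>2)"
    by (rule integrableI_bounded_set_indicator[of _ _ _ "(L / \<delta>)\<^sup>2"])
      (use J bd emeasure_bounded_finite[OF J(2)] in auto)
  have "integral {-j..j} (\<lambda>v. (cmod (?F (of_real v)))\<^sup>2) = (LINT v:{-j..j}|lborel. (cmod (?F (of_real v)))\<^sup>2)"
  proof (rule set_borel_integral_eq_integral(2)[symmetric])
    have "integrable lborel (\<lambda>v. indicator J (a + 1 * v) *\<^sub>R (cmod (h (a + 1 * v)))\<^sup>2)"
      using lborel_integrable_real_affine[OF int, of 1 a] by simp
    then have "integrable lborel (\<lambda>v. indicator {-j..j} v *\<^sub>R (indicator J (a + 1 * v) *\<^sub>R (cmod (h (a + 1 * v)))\<^sup>2))"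
      by (rule integrable_mult_indicator[rotated]) simp
    also have "(\<lambda>v. indicator {-j..j} v *\<^sub>R (indicator J (a + 1 * v) *\<^sub>R (cmod (h (a + 1 * v)))\<^sup>2))
      = (\<lambda>v. indicator {-j..j} v *\<^sub>R (cmod (?F (of_real v)))\<^sup>2)"
    proof
      fix v
      have "a + v \<in> J" if "v \<in> {-j..j}" using sub that by (auto simp: subset_iff)
      then show "indicator {-j..j} v *\<^sub>R (indicator J (a + 1 * v) *\<^sub>R (cmod (h (a + 1 * v)))\<^sup>2)
        = indicator {-j..j} v *\<^sub>R (cmod (?F (of_real v)))\<^sup>2"
        using HF[of "a + v"] Hh[of "a + v"] by (auto simp: indicator_def)
    qed
    finally show "set_integrable lborel {-j..j} (\<lambda>v. (cmod (?F (of_real v)))\<^sup>2)"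
      by (simp add: set_integrable_def)
  qed
  also have "\<dots> = (LINT v|lborel. indicator {a - j..a + j} (a + 1 * v) *\<^sub>R (cmod (h (a + 1 * v)))\<^sup>2)"
    unfolding set_lebesgue_integral_def
  proof (rule Bochner_Integration.integral_cong[OF refl])
    fix v
    have "a + v \<in> J" if "v \<in> {-j..j}" using sub that by (auto simp: subset_iff)
    then show "indicator {-j..j} v *\<^sub>R (cmod (?F (of_real v)))\<^sup>2
      = indicator {a - j..a + j} (a + 1 * v) *\<^sub>R (cmod (h (a + 1 * v)))\<^sup>2"
      using HF[of "a + v"] Hh[of "a + v"] by (auto simp: indicator_def)
  qed
  also have "\<dots> = (LINT x|lborel. indicator {a - j..a + j} x *\<^sub>R (cmod (h x))\<^sup>2)"
    using lborel_integral_real_affine[of 1 "\<lambda>x. indicator {a - j..a + j} x *\<^sub>R (cmod (h x))\<^sup>2" a] by simp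
  also have "\<dots> \<le> (LINT x|lborel. indicator J x *\<^sub>R (cmod (h x))\<^sup>2)"
    by (rule integral_mono'[OF int]) (use sub in \<open>auto simp: indicator_def\<close>)
  also have "\<dots> = (LINT x:J|lborel. (cmod (Hilbert_transform f x))\<^sup>2)"
    unfolding set_lebesgue_integral_def
    by (rule Bochner_Integration.integral_cong) (auto simp: indicator_def Hh)
  finally show ?thesis unfolding L2_norm_def by simp
qed

section \<open>Translation to the gap setting and choice of the constant\<close>

theorem theorem1p2:
  fixes I J :: "real set"
  assumes "open I" and "bounded I" and "I \<noteq> {}"
    and "open J" and "bounded J" and "J \<noteq> {}"
    and "closure I \<inter> closure J = {}"
  shows "\<exists>C>0. \<forall>f\<in>Cc_infty I.
           L2_norm I f \<le>
             C * exp (C * (H1_norm I f / L2_norm I f)) * L2_norm J (Hilbert_transform f)"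
proof -
  \<comment> \<open>The point a becomes the origin; the ball around it in J provides the gap d, and
    I lies within distance R of it.\<close>
  obtain a where "a \<in> J" using \<open>J \<noteq> {}\<close> by blast
  then obtain d where d: "0 < d" "ball a d \<subseteq> J" using \<open>open J\<close> open_contains_ball by blast
  obtain B where B: "\<And>x. x \<in> I \<Longrightarrow> \<bar>x\<bar> \<le> B" using \<open>bounded I\<close> by (auto simp: bounded_iff)
  define R where "R = max d (B + \<bar>a\<bar>)"
  have dR: "d \<le> R" "0 < R" using d by (auto simp: R_def)
  have IR: "\<bar>y - a\<bar> \<le> R" if "y \<in> I" for y using B[OF that] by (auto simp: R_def)
  have IJ: "I \<inter> J = {}" using assms(7) closure_subset by blast
  have Id: "d \<le> \<bar>y - a\<bar>" if "y \<in> I" for y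
    using that d(2) IJ by (auto simp: subset_iff dist_real_def abs_minus_commute not_less[symmetric])
  obtain \<delta> where \<delta>: "0 < \<delta>" "\<And>x y. x \<in> closure J \<Longrightarrow> y \<in> closure I \<Longrightarrow> \<delta> \<le> dist x y"
    using separate_compact_closed[of "closure J" "closure I"] assms by (auto simp: Int_commute)
  define r where "r = d / (4 * R)"
  define K where "K = 30 * ln 1152 * (3 / 2 * R + 1) / r"
  \<comment> \<open>Being at least 1 and at least K, this C serves both as prefactor and in the
    exponent.\<close>
  define C where "C = max 1 K"
  have "L2_norm I f \<le> C * exp (C * (H1_norm I f / L2_norm I f)) * L2_norm J (Hilbert_transform f)"
    if f: "f \<in> Cc_infty I" for f
  proof (cases "L2_norm I f = 0")
    \<comment> \<open>This case contains f = 0: the quotient has the value 0 by the convention for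
      division, and the right-hand side is nonnegative.\<close>
    case True
    have "0 \<le> L2_norm J (Hilbert_transform f)"
      unfolding L2_norm_def set_lebesgue_integral_def by (intro real_sqrt_ge_zero integral_nonneg_AE) auto
    then show ?thesis using True by (simp add: C_def)
  next
    case False
    define f' where "f' = (\<lambda>x. vector_derivative f (at x))"
    from f have sm: "smooth f" and S: "closure {x. f x \<noteq> 0} \<subseteq> I" by (auto simp: Cc_infty_def)
    have "f differentiable (at x)" for x
      using sm unfolding smooth_def by (metis funpow_0 nth_vderiv_def)
    then have df: "(f has_vector_derivative f' x) (at x)" for x
      unfolding f'_def by (simp add: vector_derivative_works)
    have "nth_vderiv 1 f = f'" by (simp add: nth_vderiv_def f'_def)
    then have "f' differentiable (at x)" for x using sm unfolding smooth_def by metis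
    then have cf': "continuous_on UNIV f'"
      by (simp add: continuous_at_imp_continuous_on differentiable_imp_continuous_within)
    have cf: "continuous_on UNIV f"
      using df by (intro continuous_at_imp_continuous_on) (auto intro: has_vector_derivative_continuous)
    have f0: "f x = 0" if "x \<notin> I" for x using S that closure_subset[of "{x. f x \<noteq> 0}"] by auto
    \<comment> \<open>A point outside I has a neighbourhood disjoint from the closed support, on
      which f is identically 0.\<close>
    have f'0: "f' x = 0" if "x \<notin> I" for x
    proof -
      have "(f has_vector_derivative 0) (at x)"
      proof (rule has_vector_derivative_transform_within_open[of "\<lambda>_. 0" 0 x "- closure {x. f x \<noteq> 0}" f])
        show "x \<in> - closure {x. f x \<noteq> 0}" using that S by blast
        show "0 = f y" if "y \<in> - closure {x. f x \<noteq> 0}" for y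
          using that closure_subset[of "{x. f x \<noteq> 0}"] by auto
      qed auto
      then show ?thesis unfolding f'_def by (rule vector_derivative_at)
    qed
    define g where "g = (\<lambda>u. f (a + u))"
    define g' where "g' = (\<lambda>u. f' (a + u))"
    interpret C1_gap_function g R d g'
    proof
      show "continuous_on UNIV g" "continuous_on UNIV g'" unfolding g_def g'_def
        by (auto intro!: continuous_intros continuous_on_compose2[OF cf] continuous_on_compose2[OF cf'])
      show "d \<le> \<bar>y\<bar> \<and> \<bar>y\<bar> \<le> R" if "g y \<noteq> 0" for y
        using IR[of "a + y"] Id[of "a + y"] f0[of "a + y"] that by (auto simp: g_def)
      show "(g has_vector_derivative g' x) (at x)" for x
      proof -
        have "((\<lambda>u. a + u) has_vector_derivative 1) (at x)" by (auto intro!: derivative_eq_intros)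
        from vector_diff_chain_at[OF this df] show ?thesis by (simp add: o_def g_def g'_def)
      qed
      show "g' x = 0" if "R < \<bar>x\<bar>" for x
        unfolding g'_def by (rule f'0) (use IR[of "a + x"] that in auto)
    qed (use d dR in auto)
    have far0: "f y = 0" "f' y = 0" if "R < \<bar>y - a\<bar>" for y
      using IR[of y] f0[of y] f'0[of y] that by fastforce+
    have L2: "L2_norm I f = sqrt N"
      unfolding N_def unfolding g_def by (rule L2_norm_translate[OF cf f0 far0(1)])
    have "L2_norm I f' = sqrt N'"
      unfolding N'_def unfolding g'_def by (rule L2_norm_translate[OF cf' f'0 far0(2)])
    then have M: "(H1_norm I f)\<^sup>2 = N + N'" "0 \<le> H1_norm I f"
      using L2 N_nonneg N'_nonneg by (auto simp: H1_norm_def f'_def)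
    have "0 < N" using False L2 N_nonneg by (auto simp: less_le)
    have E: "sqrt E \<le> L2_norm J (Hilbert_transform f)"
      unfolding E_def unfolding g_def
    proof (rule Hilbert_transform_L2_ge[OF cf far0(1) \<delta>(1) _ \<open>open J\<close> \<open>bounded J\<close>])
      show "\<delta> \<le> \<bar>x - y\<bar>" if "x \<in> J" "f y \<noteq> 0" for x y
      proof -
        have "x \<in> closure J" "y \<in> closure I"
          using that f0[of y] closure_subset[of J] closure_subset[of I] by auto
        then show ?thesis using \<delta>(2)[of x y] by (simp add: dist_real_def)
      qed
      have "{a - d / 2..a + d / 2} \<subseteq> ball a d" using d(1) by (auto simp: dist_real_def)
      then show "{a - d / 2..a + d / 2} \<subseteq> J" using d(2) by (rule order_trans)
    qed
    have "sqrt N \<le> exp (K * (H1_norm I f / sqrt N)) * sqrt E"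
      using L2_le_exp[OF \<open>0 < N\<close> M(2,1)] by (simp add: K_def r_def)
    also have "\<dots> \<le> (C * exp (C * (H1_norm I f / sqrt N))) * L2_norm J (Hilbert_transform f)"
    proof (intro mult_mono E)
      have "exp (K * (H1_norm I f / sqrt N)) \<le> exp (C * (H1_norm I f / sqrt N))"
        using M(2) \<open>0 < N\<close> by (auto simp: C_def intro!: mult_right_mono divide_right_mono)
      also have "\<dots> \<le> C * exp (C * (H1_norm I f / sqrt N))"
        using mult_right_mono[of 1 C "exp (C * (H1_norm I f / sqrt N))"] by (simp add: C_def)
      finally show "exp (K * (H1_norm I f / sqrt N)) \<le> C * exp (C * (H1_norm I f / sqrt N))" .
    qed (use E_nonneg in \<open>auto simp: C_def\<close>)
    finally show ?thesis by (simp add: L2)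
  qed
  moreover have "C > 0" by (simp add: C_def)
  ultimately show ?thesis by blast
qed

end
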